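(* Let $d,k,r$ be positive integers with $k<d$ and $r\ge k+2$. Then, as $n\to\infty$, $A(n,d,k,r)=\Theta(a_{d,k,r}(n))$, where $$a_{d,k,r}(n) = \begin{cases} n^{d+k\cdot\max\{r-1,\,d\}}, & \text{if } r-1\ne d,\\ n^{d(k+1)}\log n, & \text{otherwise.}\end{cases}$$
   Context: $[n]=\{1,\dots,n\}$. $A(n,d,k,r)$ is the number of ordered $r$-tuples of (not necessarily distinct) points in $[n]^d$ that lie in a common $k$-dimensional affine subspace of $\mathbb{R}^d$. Here $d,k,r$ are fixed and implied constants may depend on them. *)

theory Defs
  imports "HOL-Analysis.Analysis" "HOL-Library.Landau_Symbols"
begin

text \<open>The set \<open>[n]\<^sup>d\<close> as a subset of \<open>\<real>\<^sup>d\<close>; the dimension \<open>d\<close> is the cardinality of the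
  index type \<open>'d\<close>.\<close>

definition grid :: "nat \<Rightarrow> (real ^ 'd::finite) set" where
  "grid n = {x. \<forall>i. x $ i \<in> real ` {1..n}}"

text \<open>An ordered \<open>r\<close>-tuple is a list of length \<open>r\<close>. The first argument only fixes the dimension:
  \<open>coflat_count TYPE('d) n k r\<close> is \<open>A(n,d,k,r)\<close> with \<open>d = CARD('d)\<close>.\<close>

definition coflat_tuples :: "nat \<Rightarrow> nat \<Rightarrow> nat \<Rightarrow> (real ^ 'd::finite) list set" where
  "coflat_tuples n k r =
     {ps. length ps = r \<and> set ps \<subseteq> grid n \<and>
          (\<exists>S. affine S \<and> aff_dim S = int k \<and> set ps \<subseteq> S)}"

definition coflat_count :: "'d::finite itself \<Rightarrow> nat \<Rightarrow> nat \<Rightarrow> nat \<Rightarrow> nat" where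
  "coflat_count _ n k r = card (coflat_tuples n k r :: (real ^ 'd) list set)"

definition growth :: "nat \<Rightarrow> nat \<Rightarrow> nat \<Rightarrow> nat \<Rightarrow> real" where
  "growth d k r n =
     (if r - 1 \<noteq> d then real n ^ (d + k * max (r - 1) d)
      else real n ^ (d * (k + 1)) * ln (real n))"

end

theory Submission
  imports Defs "HOL-Number_Theory.Totient"
begin

text \<open>Subtracting the first point, one counts \<open>m\<close>-tuples of integer vectors of length \<open>O(n)\<close> and rank
  \<open>j \<le> k\<close>, where \<open>m = r - 1\<close>.

  Upper bound: up to a bounded denominator such a tuple lies in the lattice spanned by successive
  minima \<open>b\<^sub>0, \<dots>, b\<^bsub>j-1\<^esub>\<close> of the integer points of its span, with \<open>i\<close>-th coordinates
  \<open>O(n / \<bar>b\<^sub>i\<bar>)\<close>. If \<open>\<bar>b\<^sub>i\<bar>\<close> has dyadic size \<open>\<lambda>\<^sub>i\<close>, then a lattice has at least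
  \<open>\<Prod>i. \<lambda>\<^sub>i / \<lambda>\<^bsub>i-1\<^esub>\<close> comparably short bases, so that there are \<open>O(\<Prod>i. \<lambda>\<^sub>i\<^sup>d \<lambda>\<^bsub>i-1\<^esub> / \<lambda>\<^sub>i)\<close>
  lattices, each carrying \<open>O(\<Prod>i. (n / \<lambda>\<^sub>i)\<^sup>m)\<close> tuples. In the sum over dyadic
  \<open>\<lambda>\<^sub>0 \<le> \<dots> \<le> \<lambda>\<^bsub>j-1\<^esub>\<close> the smallest or the largest scales dominate if \<open>m \<noteq> d\<close>; if \<open>m = d\<close>, the factors
  \<open>\<lambda>\<^bsub>i-1\<^esub> / \<lambda>\<^sub>i\<close> leave one free scale and hence a single logarithm.

  Lower bound: for \<open>m > d\<close> use coordinate flats, for \<open>m < d\<close> repeat the first of \<open>k + 1\<close> arbitrary points.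
  For \<open>m = d\<close> use \<open>d \<times> d\<close> matrices \<open>(X | X Y)\<close> where \<open>Y\<close> is rational with denominator \<open>q\<close> and of rank
  one modulo \<open>1\<close>: there are about \<open>q\<^bsup>d-2\<^esup> \<phi>(q)\<close> such \<open>Y\<close>, each allows about \<open>(n\<^sup>k / q)\<^sup>d\<close> matrices \<open>X\<close>,
  and \<open>\<Sum>q. \<phi>(q) / q\<^sup>2\<close> diverges logarithmically.\<close>

section \<open>Successive minima\<close>

lemma span_image_lessThan_iff:
  fixes b :: "nat \<Rightarrow> 'a::real_vector"
  shows "v \<in> span (b ` {..<t}) \<longleftrightarrow> (\<exists>x. v = (\<Sum>i<t. x i *\<^sub>R b i))"
proof (induction t arbitrary: v)
  case 0
  then show ?case by simp
next
  case (Suc t)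
  have "v \<in> span (b ` {..<Suc t}) \<longleftrightarrow> (\<exists>k. v - k *\<^sub>R b t \<in> span (b ` {..<t}))"
    by (simp add: lessThan_Suc span_breakdown_eq)
  also have "\<dots> \<longleftrightarrow> (\<exists>k x. v - k *\<^sub>R b t = (\<Sum>i<t. x i *\<^sub>R b i))"
    by (simp add: Suc.IH)
  also have "\<dots> \<longleftrightarrow> (\<exists>x. v = (\<Sum>i<Suc t. x i *\<^sub>R b i))"
  proof
    assume "\<exists>k x. v - k *\<^sub>R b t = (\<Sum>i<t. x i *\<^sub>R b i)"
    then obtain k x where "v - k *\<^sub>R b t = (\<Sum>i<t. x i *\<^sub>R b i)" by blast
    then have "v = (\<Sum>i<t. x i *\<^sub>R b i) + k *\<^sub>R b t" by (simp add: algebra_simps)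
    also have "\<dots> = (\<Sum>i<Suc t. (x(t := k)) i *\<^sub>R b i)" by simp
    finally show "\<exists>x. v = (\<Sum>i<Suc t. x i *\<^sub>R b i)" by blast
  next
    assume "\<exists>x. v = (\<Sum>i<Suc t. x i *\<^sub>R b i)"
    then obtain x where "v = (\<Sum>i<Suc t. x i *\<^sub>R b i)" by blast
    then have "v - x t *\<^sub>R b t = (\<Sum>i<t. x i *\<^sub>R b i)" by simp
    then show "\<exists>k x. v - k *\<^sub>R b t = (\<Sum>i<t. x i *\<^sub>R b i)" by blast
  qed
  finally show ?case .
qed

text \<open>This is how minimality gets applied: a combination whose last coefficient is nonzero
  competes with \<open>b s\<close>, so it cannot be shorter.\<close>

lemma sum_not_in_span_prev:
  fixes b :: "nat \<Rightarrow> 'a::real_vector"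
  assumes "b s \<notin> span (b ` {..<s})" and "x s \<noteq> 0"
  shows "(\<Sum>i<Suc s. x i *\<^sub>R b i) \<notin> span (b ` {..<s})"
proof
  assume *: "(\<Sum>i<Suc s. x i *\<^sub>R b i) \<in> span (b ` {..<s})"
  have "(\<Sum>i<s. x i *\<^sub>R b i) \<in> span (b ` {..<s})"
    by (auto simp: span_image_lessThan_iff)
  with * have "x s *\<^sub>R b s \<in> span (b ` {..<s})"
    by (metis (no_types, lifting) add_diff_cancel_left' span_diff sum.lessThan_Suc)
  then have "(1 / x s) *\<^sub>R x s *\<^sub>R b s \<in> span (b ` {..<s})"
    by (rule span_scale)
  with assms show False by simp
qed

locale discrete_subgroup =
  fixes L :: "'a::euclidean_space set"
  assumes zero_mem: "0 \<in> L"
    and diff_mem: "x \<in> L \<Longrightarrow> y \<in> L \<Longrightarrow> x - y \<in> L"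
    and finite_ball: "finite {x \<in> L. norm x \<le> R}"
begin

lemma minus_mem: "x \<in> L \<Longrightarrow> - x \<in> L"
  using diff_mem[OF zero_mem] by force

lemma add_mem: "x \<in> L \<Longrightarrow> y \<in> L \<Longrightarrow> x + y \<in> L"
  using diff_mem[of x "- y"] minus_mem by force

lemma scale_nat_mem: "x \<in> L \<Longrightarrow> real n *\<^sub>R x \<in> L"
  by (induction n) (auto simp: zero_mem add_mem algebra_simps)

lemma scale_mem: "x \<in> L \<Longrightarrow> of_int c *\<^sub>R x \<in> L"
proof (cases "c \<ge> 0")
  case True
  assume "x \<in> L"
  from scale_nat_mem[OF this, of "nat c"] True show ?thesis by simp
next
  case False
  assume "x \<in> L"
  from minus_mem[OF scale_nat_mem[OF this, of "nat (- c)"]] False show ?thesis by simp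
qed

lemma sum_mem: "(\<And>i. i \<in> A \<Longrightarrow> f i \<in> L) \<Longrightarrow> sum f A \<in> L"
  by (induction A rule: infinite_finite_induct) (auto simp: zero_mem add_mem)

text \<open>Greedy successive minima: linearly independent, but in general they generate only a
  finite-index part of the group within their span, whence the denominators below.\<close>

definition minima :: "nat \<Rightarrow> (nat \<Rightarrow> 'a) \<Rightarrow> bool" where
  "minima j b \<longleftrightarrow> (\<forall>i<j. b i \<in> L \<and> b i \<notin> span (b ` {..<i}) \<and>
     (\<forall>z\<in>L. z \<notin> span (b ` {..<i}) \<longrightarrow> norm (b i) \<le> norm z))"

text \<open>Fewer than \<open>dim V\<close> vectors cannot span \<open>V\<close>, so some element of
  the group escapes their span, and discreteness yields a shortest such element.\<close>

lemma minima_exist: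
  assumes "V \<subseteq> L" and "j \<le> dim V"
  shows "\<exists>b. minima j b"
  using assms(2)
proof (induction j)
  case 0
  show ?case by (auto simp: minima_def)
next
  case (Suc t)
  then obtain b where b: "minima t b" by auto
  have "dim (span (b ` {..<t})) \<le> t"
    using dim_le_card[of "b ` {..<t}" "b ` {..<t}"] card_image_le[of "{..<t}" b] span_superset[of "b ` {..<t}"]
    by simp
  have "\<not> V \<subseteq> span (b ` {..<t})"
  proof
    assume "V \<subseteq> span (b ` {..<t})"
    then have "dim V \<le> dim (span (b ` {..<t}))" by (rule dim_subset)
    with \<open>dim (span (b ` {..<t})) \<le> t\<close> Suc.prems show False by simp
  qed
  then obtain v where v: "v \<in> V" "v \<notin> span (b ` {..<t})" by blast
  define S where "S = {x \<in> L. norm x \<le> norm v \<and> x \<notin> span (b ` {..<t})}"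
  have "finite S"
    by (rule finite_subset[OF _ finite_ball[of "norm v"]]) (auto simp: S_def)
  moreover have "v \<in> S" using v assms by (auto simp: S_def)
  ultimately have "Min (norm ` S) \<in> norm ` S" by (intro Min_in) auto
  then obtain z where z: "z \<in> S" "norm z = Min (norm ` S)" by auto
  have zmin: "norm z \<le> norm y" if "y \<in> S" for y
    unfolding z(2) using that \<open>finite S\<close> by (intro Min_le) auto
  define b' where "b' = b(t := z)"
  have im: "b' ` {..<i} = b ` {..<i}" if "i \<le> t" for i
    using that by (auto simp: b'_def intro!: image_cong)
  have "minima (Suc t) b'"
    unfolding minima_def
  proof (intro allI impI)
    fix i assume "i < Suc t"
    then consider "i < t" | "i = t" by linarith
    then show "b' i \<in> L \<and> b' i \<notin> span (b' ` {..<i}) \<and>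
      (\<forall>z\<in>L. z \<notin> span (b' ` {..<i}) \<longrightarrow> norm (b' i) \<le> norm z)"
    proof cases
      case 1
      with b im[of i] show ?thesis unfolding minima_def by (auto simp: b'_def)
    next
      case 2
      have "norm z \<le> norm y" if "y \<in> L" "y \<notin> span (b ` {..<t})" for y
        using zmin[of y] zmin[of v] that \<open>v \<in> S\<close> by (cases "norm y \<le> norm v") (auto simp: S_def intro: order_trans)
      with 2 im[of i] z(1) show ?thesis by (auto simp: b'_def S_def)
    qed
  qed
  then show ?case by blast
qed

text \<open>\<open>b l\<close> itself lies outside the smaller span, hence is a competitor for
  \<open>b i\<close>.\<close>

lemma minima_mono:
  assumes "minima j b" "i \<le> l" "l < j"
  shows "norm (b i) \<le> norm (b l)"
proof -
  have "b l \<notin> span (b ` {..<l})" "b l \<in> L" using assms by (auto simp: minima_def)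
  moreover have "span (b ` {..<i}) \<subseteq> span (b ` {..<l})"
    using assms by (intro span_mono image_mono) auto
  moreover have "\<forall>z\<in>L. z \<notin> span (b ` {..<i}) \<longrightarrow> norm (b i) \<le> norm z"
    using assms unfolding minima_def by auto
  ultimately show ?thesis by blast
qed

lemma minima_dim:
  assumes "minima j b" "t \<le> j"
  shows "dim (span (b ` {..<t})) = t"
  using assms(2)
proof (induction t)
  case (Suc t)
  have "b t \<notin> span (b ` {..<t})" using assms Suc by (auto simp: minima_def)
  then show ?case using Suc by (simp add: lessThan_Suc dim_insert)
qed simp

lemma minima_span:
  assumes "minima j b" "L \<subseteq> span V" "dim V = j"
  shows "span (b ` {..<j}) = span V"
proof (rule subspace_dim_equal)
  show "span (b ` {..<j}) \<subseteq> span V"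
    using assms by (intro span_minimal) (auto simp: minima_def)
  show "dim (span V) \<le> dim (span (b ` {..<j}))"
    using minima_dim[OF assms(1), of j] assms by simp
qed auto

text \<open>Clearing denominators costs at most the factor \<open>(4 * j + 1) ^ j\<close>: by simultaneous approximation some
  multiple of \<open>v\<close> has a remainder modulo the lattice spanned by \<open>b\<close> that is too short to be nonzero.\<close>

lemma minima_multiple:
  assumes b: "minima j b" and v: "v \<in> L" "v \<in> span (b ` {..<j})"
  shows "\<exists>q c. 0 < q \<and> q \<le> int ((4 * j + 1) ^ j) \<and> of_int q *\<^sub>R v = (\<Sum>i<j. of_int (c i) *\<^sub>R b i)"
proof -
  obtain x where x: "v = (\<Sum>i<j. x i *\<^sub>R b i)" using v span_image_lessThan_iff by blast
  define T where "T = 4 * j + 1"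
  have "T > 0" by (simp add: T_def)
  then obtain q p where q: "0 < q" "q \<le> int (T ^ j)"
    and p: "\<And>i. i < j \<Longrightarrow> \<bar>of_int q * x i - of_int (p i)\<bar> < 1 / T"
    using Dirichlet_approx_simult by blast
  define e where "e i = of_int q * x i - of_int (p i)" for i
  define w where "w = of_int q *\<^sub>R v - (\<Sum>i<j. of_int (p i) *\<^sub>R b i)"
  have w: "w = (\<Sum>i<j. e i *\<^sub>R b i)"
    by (simp add: w_def x e_def scaleR_sum_right sum_subtractf algebra_simps)
  have "w \<in> L"
    unfolding w_def using v b by (intro diff_mem scale_mem sum_mem) (auto simp: minima_def)
  have "w = 0"
  proof (rule ccontr)
    assume "w \<noteq> 0"
    then have "\<exists>i<j. e i \<noteq> 0" unfolding w by (metis (mono_tags, lifting) lessThan_iff scaleR_eq_0_iff sum.neutral)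
    \<comment> \<open>The last nonzero coordinate: \<open>w\<close> lies outside the span of the
      earlier vectors, yet it has at most \<open>j < T\<close> terms, each of norm at most
      \<open>norm (b s) / T\<close>.\<close>
    define s where "s = Max {i. i < j \<and> e i \<noteq> 0}"
    have fin: "finite {i. i < j \<and> e i \<noteq> 0}" by simp
    have s: "s < j" "e s \<noteq> 0"
      using Max_in[OF fin] \<open>\<exists>i<j. e i \<noteq> 0\<close> unfolding s_def by auto
    have smax: "e i = 0" if "s < i" "i < j" for i
      using Max_ge[OF fin, of i] that by (fold s_def) force
    have ws: "w = (\<Sum>i<Suc s. e i *\<^sub>R b i)"
      unfolding w by (rule sum.mono_neutral_right) (use s smax in \<open>auto simp: not_less less_Suc_eq_le\<close>)
    have "w \<notin> span (b ` {..<s})" unfolding ws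
      using b s by (intro sum_not_in_span_prev) (auto simp: minima_def)
    then have "norm (b s) \<le> norm w" using b s \<open>w \<in> L\<close> by (auto simp: minima_def)
    also have "\<dots> \<le> (\<Sum>i<Suc s. \<bar>e i\<bar> * norm (b i))"
      unfolding ws by (rule order_trans[OF norm_sum]) simp
    also have "\<dots> \<le> (\<Sum>i<Suc s. (1 / T) * norm (b s))"
    proof (rule sum_mono, rule mult_mono)
      fix i assume "i \<in> {..<Suc s}"
      then show "\<bar>e i\<bar> \<le> 1 / T" using p[of i] s by (simp add: e_def less_imp_le)
      show "norm (b i) \<le> norm (b s)" using minima_mono[OF b, of i s] s \<open>i \<in> {..<Suc s}\<close> by auto
    qed auto
    also have "\<dots> = (real (Suc s) / T) * norm (b s)" by simp
    also have "\<dots> < 1 * norm (b s)"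
    proof (rule mult_strict_right_mono)
      show "real (Suc s) / T < 1" using s by (simp add: T_def divide_simps)
      have "b s \<noteq> 0" using b s span_zero[of "b ` {..<s}"] unfolding minima_def by metis
      then show "norm (b s) > 0" by simp
    qed
    finally show False by simp
  qed
  then have "of_int q *\<^sub>R v = (\<Sum>i<j. of_int (p i) *\<^sub>R b i)" by (simp add: w_def)
  with q show ?thesis unfolding T_def by blast
qed

text \<open>The index \<open>s\<close> maximising \<open>\<bar>x i\<bar> * norm (b i)\<close> with the geometric weights \<open>\<kappa> ^ i\<close> makes the
  coordinates beyond \<open>s\<close> negligible; those up to \<open>s\<close> are rounded simultaneously.\<close>

lemma minima_coordinates:
  fixes j :: nat
  defines "Q \<equiv> real ((4 * j + 1) ^ j)"
  defines "\<kappa> \<equiv> (4 * real j + 1) * Q"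
  assumes b: "minima j b" and i: "i < j"
  shows "\<bar>x i\<bar> * norm (b i) \<le> 2 * Q * \<kappa> ^ j * norm (\<Sum>l<j. x l *\<^sub>R b l)"
proof -
  define T where "T = 4 * j + 1"
  have "T > 0" by (simp add: T_def)
  have Q1: "Q \<ge> 1" unfolding Q_def by simp
  have \<kappa>1: "\<kappa> \<ge> 1" using mult_mono[of 1 "4 * real j + 1" 1 Q] Q1 by (simp add: \<kappa>_def)
  define g where "g l = \<bar>x l\<bar> * norm (b l) * \<kappa> ^ l" for l
  have "finite {..<j}" "{..<j} \<noteq> {}" using i by auto
  then have "Max (g ` {..<j}) \<in> g ` {..<j}" by (intro Max_in) auto
  then obtain s where s: "s < j" "g s = Max (g ` {..<j})" by auto
  have smax: "g l \<le> g s" if "l < j" for l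
    unfolding s(2) using that by (intro Max_ge) auto
  note s = s(1)
  define u where "u = (\<Sum>l<j. x l *\<^sub>R b l)"
  have nz: "b l \<noteq> 0" if "l < j" for l
    using b that span_zero[of "b ` {..<l}"] unfolding minima_def by metis
  have key: "norm (b s) * \<bar>x s\<bar> \<le> 2 * Q * norm u"
  proof (cases "x s = 0")
    case True
    then show ?thesis using Q1 by simp
  next
    case False
    \<comment> \<open>Dividing by \<open>x s\<close> turns the coordinate at \<open>s\<close> into
      1, so that its multiple by \<open>q\<close> is rounded to \<open>q\<close> exactly and
      \<open>w\<close> keeps a nonzero last coefficient.\<close>
    define y where "y l = x l / x s" for l
    have ybound: "\<bar>y l\<bar> * norm (b l) \<le> norm (b s) / \<kappa>" if "s < l" "l < j" for l
    proof -
      have "\<bar>x l\<bar> * norm (b l) * \<kappa> ^ Suc s \<le> \<bar>x l\<bar> * norm (b l) * \<kappa> ^ l"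
        using that \<kappa>1 by (intro mult_left_mono power_increasing) auto
      also have "\<dots> \<le> \<bar>x s\<bar> * norm (b s) * \<kappa> ^ s" using smax[OF that(2)] by (simp add: g_def)
      finally have "(\<bar>x l\<bar> * norm (b l) * \<kappa>) * \<kappa> ^ s \<le> \<bar>x s\<bar> * norm (b s) * \<kappa> ^ s" by (simp add: algebra_simps)
      then have "\<bar>x l\<bar> * norm (b l) * \<kappa> \<le> \<bar>x s\<bar> * norm (b s)"
        using \<kappa>1 by (simp add: mult_le_cancel_right)
      then show ?thesis using False \<kappa>1 by (simp add: y_def field_simps)
    qed
    obtain q p where q: "0 < q" "q \<le> int (T ^ j)"
      and p: "\<And>l. l < j \<Longrightarrow> \<bar>of_int q * y l - of_int (p l)\<bar> < 1 / T"
      using Dirichlet_approx_simult[OF \<open>T > 0\<close>] by blast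
    have qQ: "of_int q \<le> Q"
    proof -
      have "real_of_int q \<le> real_of_int (int (T ^ j))" using q(2) by (subst of_int_le_iff)
      then show ?thesis by (simp add: Q_def T_def)
    qed
    have ps: "p s = q"
    proof -
      have "\<bar>real_of_int q - of_int (p s)\<bar> < 1 / T" using p[OF s] False by (simp add: y_def)
      also have "\<dots> \<le> 1" by (simp add: T_def)
      finally have "\<bar>q - p s\<bar> < 1" by linarith
      then show ?thesis by simp
    qed
    define w where "w = (\<Sum>l<Suc s. of_int (p l) *\<^sub>R b l)"
    have "w \<in> L"
      unfolding w_def using b s by (intro scale_mem sum_mem) (auto simp: minima_def)
    have "w \<notin> span (b ` {..<s})" unfolding w_def
      using b s ps q by (intro sum_not_in_span_prev) (auto simp: minima_def)
    then have bw: "norm (b s) \<le> norm w" using b s \<open>w \<in> L\<close> by (auto simp: minima_def)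
    \<comment> \<open>Beyond \<open>s\<close> nothing is subtracted: there the error is the whole
      coordinate, and the factor \<kappa> gained in \<open>ybound\<close> compensates for
      \<open>q\<close>, which may be as large as \<open>Q\<close>.\<close>
    define e where "e l = (if l < Suc s then of_int q * y l - of_int (p l) else of_int q * y l)" for l
    have "{..<j} \<inter> {l. l < Suc s} = {..<Suc s}" using s by auto
    then have "w = (\<Sum>l<j. (if l < Suc s then of_int (p l) *\<^sub>R b l else 0))"
      by (simp add: w_def sum.inter_restrict[symmetric] sum.If_cases)
    also have "\<dots> = (\<Sum>l<j. of_int q *\<^sub>R y l *\<^sub>R b l - e l *\<^sub>R b l)"
      by (intro sum.cong) (auto simp: e_def algebra_simps)
    also have "\<dots> = of_int q *\<^sub>R (1 / x s) *\<^sub>R u - (\<Sum>l<j. e l *\<^sub>R b l)"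
      by (simp add: sum_subtractf u_def scaleR_sum_right y_def)
    finally have weq: "w = of_int q *\<^sub>R (1 / x s) *\<^sub>R u - (\<Sum>l<j. e l *\<^sub>R b l)" .
    have eb: "\<bar>e l\<bar> * norm (b l) \<le> norm (b s) / T" if "l < j" for l
    proof (cases "l < Suc s")
      case True
      have "\<bar>e l\<bar> * norm (b l) \<le> (1 / T) * norm (b s)"
        using True p[OF that] minima_mono[OF b, of l s] s by (intro mult_mono) (auto simp: e_def)
      then show ?thesis by simp
    next
      case False
      have "\<bar>e l\<bar> * norm (b l) = of_int q * (\<bar>y l\<bar> * norm (b l))"
        using False q by (simp add: e_def abs_mult)
      also have "\<dots> \<le> Q * (norm (b s) / \<kappa>)"
        using qQ q ybound[of l] False that by (intro mult_mono) auto
      also have "\<dots> = norm (b s) / T" using Q1 by (simp add: \<kappa>_def T_def)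
      finally show ?thesis .
    qed
    have "norm (\<Sum>l<j. e l *\<^sub>R b l) \<le> (\<Sum>l<j. \<bar>e l\<bar> * norm (b l))"
      by (rule order_trans[OF norm_sum]) simp
    also have "\<dots> \<le> (\<Sum>l<j. norm (b s) / T)" by (intro sum_mono eb) auto
    also have "\<dots> = (real j / T) * norm (b s)" by simp
    also have "\<dots> \<le> (1 / 2) * norm (b s)"
      by (intro mult_right_mono) (auto simp: T_def divide_simps)
    \<comment> \<open>The errors cost at most half of \<open>norm (b s)\<close>, so the multiple of
      \<open>u\<close> inside \<open>w\<close> has norm at least the other half.\<close>
    finally have e2: "norm (\<Sum>l<j. e l *\<^sub>R b l) \<le> norm (b s) / 2" by simp
    have "norm w \<le> of_int q * norm u / \<bar>x s\<bar> + norm (b s) / 2"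
      unfolding weq by (rule order_trans[OF norm_triangle_ineq4]) (use e2 q in simp)
    then have "norm (b s) \<le> 2 * of_int q * norm u / \<bar>x s\<bar>" using bw by simp
    then have "norm (b s) * \<bar>x s\<bar> \<le> 2 * of_int q * norm u" using False by (simp add: field_simps)
    also have "\<dots> \<le> 2 * Q * norm u" using qQ by (intro mult_right_mono) auto
    finally show ?thesis .
  qed
  have "\<bar>x i\<bar> * norm (b i) \<le> g i"
    unfolding g_def using \<kappa>1 mult_left_mono[of 1 "\<kappa> ^ i" "\<bar>x i\<bar> * norm (b i)"] by simp
  also have "\<dots> \<le> g s" by (rule smax[OF i])
  also have "\<dots> = norm (b s) * \<bar>x s\<bar> * \<kappa> ^ s" by (simp add: g_def)
  also have "\<dots> \<le> (2 * Q * norm u) * \<kappa> ^ j"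
    by (rule mult_mono[OF key power_increasing]) (use s \<kappa>1 Q1 in auto)
  finally show ?thesis by (simp add: u_def algebra_simps)
qed

end

section \<open>Integer vectors and norm-reduced bases\<close>

definition int_vecs :: "(real ^ 'd) set" where
  "int_vecs = {x. \<forall>i. x $ i \<in> \<int>}"

lemma
  fixes A :: "'a set"
  assumes "finite A"
  shows finite_vec_components: "finite {x :: 'a ^ 'n::finite. \<forall>i. x $ i \<in> A}"
    and card_vec_components: "card {x :: 'a ^ 'n::finite. \<forall>i. x $ i \<in> A} = card A ^ CARD('n)"
proof -
  have bij: "bij_betw vec_nth {x :: 'a ^ 'n. \<forall>i. x $ i \<in> A} (PiE UNIV (\<lambda>_. A))"
    by (rule bij_betwI[where g = vec_lambda]) auto
  show "finite {x :: 'a ^ 'n. \<forall>i. x $ i \<in> A}"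
    using bij_betw_finite[OF bij] assms by (simp add: finite_PiE)
  show "card {x :: 'a ^ 'n. \<forall>i. x $ i \<in> A} = card A ^ CARD('n)"
    using bij_betw_same_card[OF bij] by (simp add: card_PiE)
qed

lemma
  shows finite_Ints_interval: "finite {x \<in> \<int>. \<bar>x\<bar> \<le> (R::real)}"
    and card_Ints_interval: "R \<ge> 1 \<Longrightarrow> real (card {x \<in> \<int>. \<bar>x\<bar> \<le> (R::real)}) \<le> 3 * R"
proof -
  have sub: "{x \<in> \<int>. \<bar>x\<bar> \<le> R} \<subseteq> real_of_int ` {-\<lfloor>R\<rfloor>..\<lfloor>R\<rfloor>}"
  proof
    fix x assume x: "x \<in> {x \<in> \<int>. \<bar>x\<bar> \<le> R}"
    then obtain z where z: "x = of_int z" by (auto elim: Ints_cases)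
    with x have "of_int z \<le> R" "of_int (- z) \<le> R" by auto
    then have "z \<le> \<lfloor>R\<rfloor>" "- z \<le> \<lfloor>R\<rfloor>" by (simp_all only: le_floor_iff)
    then show "x \<in> real_of_int ` {-\<lfloor>R\<rfloor>..\<lfloor>R\<rfloor>}" using z by auto
  qed
  then show "finite {x \<in> \<int>. \<bar>x\<bar> \<le> R}" by (rule finite_subset) auto
  assume "R \<ge> 1"
  have "card {x \<in> \<int>. \<bar>x\<bar> \<le> R} \<le> card {-\<lfloor>R\<rfloor>..\<lfloor>R\<rfloor>}"
    by (rule order_trans[OF card_mono[OF _ sub] card_image_le]) auto
  also have "\<dots> = nat (2 * \<lfloor>R\<rfloor> + 1)" by simp
  finally have "real (card {x \<in> \<int>. \<bar>x\<bar> \<le> R}) \<le> real (nat (2 * \<lfloor>R\<rfloor> + 1))"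
    by (subst of_nat_le_iff)
  also have "\<dots> = 2 * of_int \<lfloor>R\<rfloor> + 1" using \<open>R \<ge> 1\<close> by simp
  also have "\<dots> \<le> 2 * R + 1" by simp
  finally show "real (card {x \<in> \<int>. \<bar>x\<bar> \<le> R}) \<le> 3 * R" using \<open>R \<ge> 1\<close> by simp
qed

lemma
  shows finite_int_vecs_ball: "finite {z \<in> (int_vecs :: (real ^ 'd::finite) set). norm z \<le> R}"
    and card_int_vecs_ball:
      "R \<ge> 1 \<Longrightarrow> real (card {z \<in> (int_vecs :: (real ^ 'd::finite) set). norm z \<le> R}) \<le> (3 * R) ^ CARD('d)"
proof -
  let ?B = "{z \<in> (int_vecs :: (real ^ 'd) set). norm z \<le> R}"
  let ?C = "{z :: real ^ 'd. \<forall>i. z $ i \<in> {x \<in> \<int>. \<bar>x\<bar> \<le> R}}"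
  have sub: "?B \<subseteq> ?C"
    by (auto simp: int_vecs_def intro: order_trans[OF component_le_norm_cart])
  have fin: "finite ?C" by (rule finite_vec_components[OF finite_Ints_interval])
  show "finite ?B" by (rule finite_subset[OF sub fin])
  assume R: "R \<ge> 1"
  have "card ?B \<le> card ?C" by (rule card_mono[OF fin sub])
  also have "\<dots> = card {x \<in> \<int>. \<bar>x\<bar> \<le> R} ^ CARD('d)"
    by (rule card_vec_components[OF finite_Ints_interval])
  finally have "real (card ?B) \<le> real (card {x \<in> \<int>. \<bar>x\<bar> \<le> R}) ^ CARD('d)"
    by (simp flip: of_nat_power)
  also have "\<dots> \<le> (3 * R) ^ CARD('d)"
    by (rule power_mono[OF card_Ints_interval[OF R]]) simp
  finally show "real (card ?B) \<le> (3 * R) ^ CARD('d)" .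
qed

lemma int_vecs_norm_ge_1:
  assumes "z \<in> int_vecs" "z \<noteq> 0"
  shows "norm z \<ge> 1"
proof -
  obtain i where "z $ i \<noteq> 0" using assms(2) by (auto simp: vec_eq_iff)
  moreover have "z $ i \<in> \<int>" using assms(1) by (simp add: int_vecs_def)
  ultimately have "1 \<le> \<bar>z $ i\<bar>" by (rule Ints_nonzero_abs_ge1[rotated])
  then show ?thesis using component_le_norm_cart[of z i] by linarith
qed

lemma discrete_subgroup_int_vecs: "discrete_subgroup (int_vecs \<inter> span V :: (real ^ 'd::finite) set)"
proof
  show "(0 :: real ^ 'd) \<in> int_vecs \<inter> span V" by (simp add: int_vecs_def span_zero)
  show "x - y \<in> int_vecs \<inter> span V" if "x \<in> int_vecs \<inter> span V" "y \<in> int_vecs \<inter> span V" for x y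
    using that by (auto simp: int_vecs_def span_diff)
  show "finite {x \<in> int_vecs \<inter> span V. norm x \<le> R}" for R
    by (rule finite_subset[OF _ finite_int_vecs_ball[of R]]) auto
qed

definition zspan :: "nat \<Rightarrow> (nat \<Rightarrow> 'a::real_vector) \<Rightarrow> 'a set" where
  "zspan j b = range (\<lambda>c. \<Sum>i<j. of_int (c i) *\<^sub>R b i)"

text \<open>What the counting needs from successive minima. The last clause is linear independence
  made quantitative: each term of a combination is at most \<open>K\<close> times the whole in
  norm.\<close>

definition norm_reduced :: "real \<Rightarrow> nat \<Rightarrow> (nat \<Rightarrow> real ^ 'd::finite) \<Rightarrow> bool" where
  "norm_reduced K j b \<longleftrightarrow>
     (\<forall>i<j. b i \<in> int_vecs \<and> b i \<noteq> 0) \<and>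
     (\<forall>i l. i \<le> l \<longrightarrow> l < j \<longrightarrow> norm (b i) \<le> norm (b l)) \<and>
     (\<forall>x. \<forall>i<j. \<bar>x i\<bar> * norm (b i) \<le> K * norm (\<Sum>l<j. x l *\<^sub>R b l))"

text \<open>Take successive minima of the integer points in \<open>span V\<close>. None exceeds
  \<open>N\<close>, because fewer than \<open>j\<close> vectors cannot span \<open>V\<close>. The
  denominators from \<open>minima_multiple\<close> vary with \<open>v\<close> but do not exceed a
  bound \<open>q\<close> that depends on \<open>j\<close> only, so \<open>fact q\<close> clears them
  all.\<close>

lemma norm_reduced_exists:
  "\<exists>K D. 1 \<le> K \<and> 0 < D \<and>
     (\<forall>N (V :: (real ^ 'd::finite) set). V \<subseteq> int_vecs \<longrightarrow> (\<forall>v\<in>V. norm v \<le> N) \<longrightarrow> dim V = j \<longrightarrow>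
       (\<exists>b. norm_reduced K j b \<and> (\<forall>i<j. norm (b i) \<le> N) \<and> (\<forall>v\<in>V. real D *\<^sub>R v \<in> zspan j b)))"
proof -
  define q where "q = (4 * j + 1) ^ j"
  define K where "K = 2 * real q * ((4 * real j + 1) * real q) ^ j"
  have q1: "real q \<ge> 1" by (simp add: q_def)
  have "1 \<le> (4 * real j + 1) * real q" using mult_mono[of 1 "4 * real j + 1" 1 "real q"] q1 by simp
  then have "1 \<le> ((4 * real j + 1) * real q) ^ j" by (rule one_le_power)
  then have K1: "1 \<le> K" unfolding K_def using mult_mono[of 1 "2 * real q" 1] q1 by simp
  have main: "\<exists>b. norm_reduced K j b \<and> (\<forall>i<j. norm (b i) \<le> N) \<and> (\<forall>v\<in>V. real (fact q) *\<^sub>R v \<in> zspan j b)"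
    if V: "V \<subseteq> int_vecs" "\<And>v. v \<in> V \<Longrightarrow> norm v \<le> N" "dim V = j" for N and V :: "(real ^ 'd) set"
  proof -
    interpret discrete_subgroup "int_vecs \<inter> span V" by (rule discrete_subgroup_int_vecs)
    have VL: "V \<subseteq> int_vecs \<inter> span V" using V span_superset by auto
    then obtain b where b: "minima j b" using minima_exist V(3) by blast
    have nz: "b i \<noteq> 0" if "i < j" for i
      using b that span_zero[of "b ` {..<i}"] unfolding minima_def by metis
    have "norm_reduced K j b"
      unfolding norm_reduced_def
    proof (intro conjI allI impI)
      show "b i \<in> int_vecs" if "i < j" for i using b that by (simp add: minima_def)
      show "\<bar>x i\<bar> * norm (b i) \<le> K * norm (\<Sum>l<j. x l *\<^sub>R b l)" if "i < j" for x i
        using minima_coordinates[OF b that, of x] by (simp only: K_def q_def)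
    qed (use minima_mono[OF b] nz in blast)+
    moreover have "norm (b i) \<le> N" if "i < j" for i
    proof -
      have "\<not> V \<subseteq> span (b ` {..<i})"
      proof
        assume "V \<subseteq> span (b ` {..<i})"
        from dim_subset[OF this] minima_dim[OF b, of i] V(3) \<open>i < j\<close> show False by simp
      qed
      then obtain v where "v \<in> V" "v \<notin> span (b ` {..<i})" by blast
      moreover from this have "norm (b i) \<le> norm v" using b that VL by (auto simp: minima_def)
      ultimately show ?thesis using V(2)[of v] by linarith
    qed
    moreover have "real (fact q) *\<^sub>R v \<in> zspan j b" if v: "v \<in> V" for v
    proof -
      have "v \<in> span (b ` {..<j})"
        using minima_span[OF b _ V(3)] v span_superset by auto
      then obtain t c where t: "0 < t" "t \<le> int q" "of_int t *\<^sub>R v = (\<Sum>i<j. of_int (c i) *\<^sub>R b i)"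
        using minima_multiple[OF b, of v] v VL unfolding q_def by blast
      have "nat t dvd fact q" using t by (intro dvd_fact) auto
      then obtain s where s: "fact q = nat t * s" by blast
      have "real (fact q) *\<^sub>R v = real s *\<^sub>R of_int t *\<^sub>R v"
      proof -
        have "real (fact q) = real s * of_int t" unfolding s using t(1) by simp
        then show ?thesis by (simp only: scaleR_scaleR)
      qed
      also have "\<dots> = (\<Sum>i<j. of_int (int s * c i) *\<^sub>R b i)"
        by (simp add: t(3) scaleR_sum_right)
      finally show ?thesis unfolding zspan_def by (intro image_eqI[of _ _ "\<lambda>i. int s * c i"]) auto
    qed
    ultimately show ?thesis by blast
  qed
  show ?thesis
  proof (rule exI[of _ K], rule exI[of _ "fact q"], intro conjI allI impI)
    show "1 \<le> K" by (rule K1)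
    show "0 < (fact q :: nat)" by (rule fact_gt_zero)
  next
    fix N and V :: "(real ^ 'd) set"
    assume "V \<subseteq> int_vecs" "\<forall>v\<in>V. norm v \<le> N" "dim V = j"
    then show "\<exists>b. norm_reduced K j b \<and> (\<forall>i<j. norm (b i) \<le> N) \<and> (\<forall>v\<in>V. real (fact q) *\<^sub>R v \<in> zspan j b)"
      using main by blast
  qed
qed

lemma norm_reduced_coordinate:
  assumes "norm_reduced K j b" "i < j"
  shows "\<bar>x i\<bar> * norm (b i) \<le> K * norm (\<Sum>l<j. x l *\<^sub>R b l)"
  using assms(2) conjunct2[OF conjunct2[OF assms(1)[unfolded norm_reduced_def]], THEN spec, of x] by simp

section \<open>Integer tuples of given rank\<close>

text \<open>A vector \<open>v\<close> is determined by the integer coordinates of its multiple by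
  \<open>D\<close>, and the last clause of \<open>norm_reduced\<close> confines the
  \<open>i\<close>-th one to an interval of radius \<open>R i\<close>. As
  \<open>R i \<ge> 1\<close>, that interval holds at most \<open>3 * R i\<close> integers.\<close>

lemma
  assumes b: "norm_reduced K j b" and K: "1 \<le> K" "0 < D" and N: "\<And>i. i < j \<Longrightarrow> norm (b i) \<le> N"
  shows finite_zspan_multiples: "finite {v. norm v \<le> N \<and> real D *\<^sub>R v \<in> zspan j b}"
    and card_zspan_multiples: "real (card {v. norm v \<le> N \<and> real D *\<^sub>R v \<in> zspan j b}) \<le>
      (\<Prod>i<j. 3 * (K * real D * N / norm (b i)))"
proof -
  let ?S = "{v. norm v \<le> N \<and> real D *\<^sub>R v \<in> zspan j b}"
  define R where "R i = K * real D * N / norm (b i)" for i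
  define P where "P = PiE {..<j} (\<lambda>i. {x \<in> \<int>. \<bar>x\<bar> \<le> R i})"
  define g where "g x = (1 / real D) *\<^sub>R (\<Sum>i<j. x i *\<^sub>R b i)" for x :: "nat \<Rightarrow> real"
  have pos: "norm (b i) > 0" if "i < j" for i using b that by (simp add: norm_reduced_def)
  have R1: "R i \<ge> 1" if "i < j" for i
  proof -
    have "1 * 1 \<le> K * real D" using K by (intro mult_mono) auto
    then have "1 * norm (b i) \<le> K * real D * N" using N[OF that] pos[OF that]
      by (intro mult_mono) auto
    then show ?thesis using pos[OF that] by (simp add: R_def)
  qed
  have finP: "finite P" unfolding P_def by (intro finite_PiE finite_Ints_interval) auto
  have sub: "?S \<subseteq> g ` P"
  proof
    fix v assume v: "v \<in> ?S"
    then obtain c where c: "real D *\<^sub>R v = (\<Sum>i<j. real_of_int (c i) *\<^sub>R b i)" by (auto simp: zspan_def)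
    define x where "x = restrict (\<lambda>i. real_of_int (c i)) {..<j}"
    have "v = g x" using K unfolding g_def x_def by (simp flip: c)
    moreover have "x \<in> P" unfolding P_def
    proof (rule PiE_I)
      fix i assume i: "i \<in> {..<j}"
      have "\<bar>real_of_int (c i)\<bar> * norm (b i) \<le> K * norm (\<Sum>l<j. real_of_int (c l) *\<^sub>R b l)"
        using i by (intro norm_reduced_coordinate[OF b]) auto
      also have "\<dots> = K * (real D * norm v)" by (simp flip: c)
      also have "\<dots> \<le> K * (real D * N)" using v K by (intro mult_left_mono) auto
      finally show "x i \<in> {x \<in> \<int>. \<bar>x\<bar> \<le> R i}"
        using i pos[of i] by (simp add: x_def R_def field_simps)
    qed (auto simp: x_def)
    ultimately show "v \<in> g ` P" by blast
  qed
  show "finite ?S" by (rule finite_subset[OF sub]) (use finP in auto)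
  have "card ?S \<le> card P"
    using card_mono[OF _ sub] card_image_le[OF finP, of g] finP by simp
  also have "card P = (\<Prod>i<j. card {x \<in> \<int>. \<bar>x\<bar> \<le> R i})" unfolding P_def by (simp add: card_PiE)
  finally have "real (card ?S) \<le> real (\<Prod>i<j. card {x \<in> \<int>. \<bar>x\<bar> \<le> R i})" by (subst of_nat_le_iff)
  also have "\<dots> = (\<Prod>i<j. real (card {x \<in> \<int>. \<bar>x\<bar> \<le> R i}))" by simp
  also have "\<dots> \<le> (\<Prod>i<j. 3 * R i)"
    by (intro prod_mono conjI card_Ints_interval R1) auto
  finally show "real (card ?S) \<le> (\<Prod>i<j. 3 * (K * real D * N / norm (b i)))" by (simp only: R_def)
qed

section \<open>Lattices of given dyadic profile and their sheared bases\<close>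

lemma zspanI: "v = (\<Sum>i<j. of_int (c i) *\<^sub>R b i) \<Longrightarrow> v \<in> zspan j b"
  unfolding zspan_def by (rule image_eqI) auto

lemma zspan_minimal:
  assumes "\<And>i. i < j \<Longrightarrow> b' i \<in> zspan j b"
  shows "zspan j b' \<subseteq> zspan j b"
proof -
  obtain c where c: "\<And>i. i < j \<Longrightarrow> b' i = (\<Sum>l<j. of_int (c i l) *\<^sub>R b l)"
    using assms unfolding zspan_def image_iff by metis
  have "(\<Sum>i<j. of_int (a i) *\<^sub>R b' i) \<in> zspan j b" for a
  proof -
    have "(\<Sum>i<j. of_int (a i) *\<^sub>R b' i) = (\<Sum>i<j. \<Sum>l<j. of_int (a i * c i l) *\<^sub>R b l)"
      by (intro sum.cong refl) (simp add: c scaleR_sum_right)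
    also have "\<dots> = (\<Sum>l<j. of_int (\<Sum>i<j. a i * c i l) *\<^sub>R b l)"
      by (subst sum.swap) (simp add: scaleR_sum_left)
    finally show ?thesis by (rule zspanI)
  qed
  then show ?thesis by (auto simp: zspan_def)
qed

lemma zspan_add_scale:
  assumes "x \<in> zspan j b" "y \<in> zspan j b"
  shows "x + of_int a *\<^sub>R y \<in> zspan j b"
proof -
  obtain c d where "x = (\<Sum>l<j. of_int (c l) *\<^sub>R b l)" "y = (\<Sum>l<j. of_int (d l) *\<^sub>R b l)"
    using assms by (auto simp: zspan_def)
  then have "x + of_int a *\<^sub>R y = (\<Sum>l<j. of_int (c l + a * d l) *\<^sub>R b l)"
    by (simp add: scaleR_sum_right sum.distrib algebra_simps)
  then show ?thesis by (rule zspanI)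
qed

lemma zspan_base: "i < j \<Longrightarrow> b i \<in> zspan j b"
  unfolding zspan_def
  by (rule range_eqI[of _ _ "\<lambda>l. if l = i then 1 else 0"]) (simp add: if_distrib[of "\<lambda>c. c *\<^sub>R _"] if_distrib[of of_int] cong: if_cong)

text \<open>A unipotent bidiagonal change of basis. Each vector changes only by a multiple of its
  predecessor, which in a reduced basis is no longer than it, so lengths stay under control.\<close>

definition shear :: "(nat \<Rightarrow> nat) \<Rightarrow> (nat \<Rightarrow> 'a::real_vector) \<Rightarrow> nat \<Rightarrow> 'a" where
  "shear u b i = (if i = 0 then b 0 else b i + real (u i) *\<^sub>R b (i - 1))"

text \<open>The inverse is integral too: \<open>b i\<close> is recovered from the sheared vectors by
  induction on \<open>i\<close>.\<close>

lemma zspan_shear: "zspan j (shear u b) = zspan j b"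
proof
  show "zspan j (shear u b) \<subseteq> zspan j b"
  proof (rule zspan_minimal)
    fix i assume "i < j"
    then show "shear u b i \<in> zspan j b"
      using zspan_add_scale[of "b i" j b "b (i - 1)" "int (u i)"] zspan_base[of i j b] zspan_base[of "i - 1" j b]
      by (auto simp: shear_def)
  qed
  have "b i \<in> zspan j (shear u b)" if "i < j" for i
    using that
  proof (induction i)
    case 0
    then show ?case using zspan_base[of 0 j "shear u b"] by (simp add: shear_def[of u b 0])
  next
    case (Suc i)
    have "b (Suc i) = shear u b (Suc i) + of_int (- int (u (Suc i))) *\<^sub>R b i" by (simp add: shear_def)
    also have "\<dots> \<in> zspan j (shear u b)"
      using Suc by (intro zspan_add_scale zspan_base) auto
    finally show ?case .
  qed
  then show "zspan j b \<subseteq> zspan j (shear u b)" by (rule zspan_minimal)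
qed

lemma zspan_cong: "(\<And>i. i < j \<Longrightarrow> b i = b' i) \<Longrightarrow> zspan j b = zspan j b'"
  unfolding zspan_def by (intro image_cong refl sum.cong) auto

definition lattices_of_profile :: "real \<Rightarrow> nat \<Rightarrow> (nat \<Rightarrow> nat) \<Rightarrow> (real ^ 'd::finite) set set" where
  "lattices_of_profile K j e =
     zspan j ` {b. norm_reduced K j b \<and> (\<forall>i<j. 2 ^ e i \<le> norm (b i) \<and> norm (b i) < 2 ^ (e i + 1))}"

text \<open>Every lattice of profile \<open>e\<close> has \<open>\<Prod>i. 2 ^ (e i - e (i - 1))\<close> sheared bases that are not
  much longer than the reduced one, and distinct lattices have distinct bases.\<close>

lemma
  fixes e :: "nat \<Rightarrow> nat"
  assumes mono: "\<And>i. Suc i < j \<Longrightarrow> e i \<le> e (Suc i)"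
  shows finite_lattices_of_profile: "finite (lattices_of_profile K j e :: (real ^ 'd::finite) set set)"
    and card_lattices_of_profile:
      "real (card (lattices_of_profile K j e :: (real ^ 'd::finite) set set)) * (\<Prod>i=1..<j. 2 ^ (e i - e (i - 1)))
        \<le> (\<Prod>i<j. (12 * 2 ^ e i) ^ CARD('d))"
proof -
  define \<L> where "\<L> = (lattices_of_profile K j e :: (real ^ 'd) set set)"
  \<comment> \<open>With \<open>u i\<close> below this power, the added multiple of the predecessor
    is at most comparable with the \<open>i\<close>-th basis vector.\<close>
  define U where "U = PiE {1..<j} (\<lambda>i. {..<(2::nat) ^ (e i - e (i - 1))})"
  have "\<forall>L\<in>\<L>. \<exists>b. L = zspan j b \<and> norm_reduced K j b \<and> (\<forall>i<j. 2 ^ e i \<le> norm (b i) \<and> norm (b i) < 2 ^ (e i + 1))"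
    by (auto simp: \<L>_def lattices_of_profile_def)
  then obtain \<beta> where \<beta>: "\<And>L. L \<in> \<L> \<Longrightarrow> L = zspan j (\<beta> L)" "\<And>L. L \<in> \<L> \<Longrightarrow> norm_reduced K j (\<beta> L)"
    "\<And>L i. L \<in> \<L> \<Longrightarrow> i < j \<Longrightarrow> norm (\<beta> L i) < 2 ^ (e i + 1)"
    by metis
  have nz: "\<beta> L i \<noteq> 0" if "L \<in> \<L>" "i < j" for L i
    using \<beta>(2)[OF that(1)] that(2) by (simp add: norm_reduced_def)
  define T where "T = PiE {..<j} (\<lambda>i. {z \<in> (int_vecs :: (real ^ 'd) set). norm z \<le> 4 * 2 ^ e i})"
  define g where "g = (\<lambda>(L, u). restrict (shear u (\<beta> L)) {..<j})"
  have finT: "finite T" unfolding T_def by (intro finite_PiE finite_int_vecs_ball) auto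
  have gT: "g ` (\<L> \<times> U) \<subseteq> T"
  proof
    fix y assume "y \<in> g ` (\<L> \<times> U)"
    then obtain L u where Lu: "L \<in> \<L>" "u \<in> U" and y: "y = restrict (shear u (\<beta> L)) {..<j}"
      by (auto simp: g_def)
    have "shear u (\<beta> L) i \<in> int_vecs \<and> norm (shear u (\<beta> L) i) \<le> 4 * 2 ^ e i" if i: "i < j" for i
    proof (cases i)
      case 0
      have "norm (\<beta> L i) \<le> 4 * 2 ^ e i"
      proof -
        have "0 \<le> (2::real) ^ e i" "norm (\<beta> L i) < 2 * 2 ^ e i" using \<beta>(3)[OF Lu(1) i] by simp_all
        then show ?thesis by linarith
      qed
      then show ?thesis using \<beta>(2)[OF Lu(1)] i 0 by (auto simp: shear_def norm_reduced_def)
    next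
      case (Suc l)
      then have l: "l < j" using i by simp
      have int: "\<beta> L i \<in> int_vecs" "\<beta> L l \<in> int_vecs"
        using \<beta>(2)[OF Lu(1)] i l by (auto simp: norm_reduced_def)
      have "u i < 2 ^ (e i - e l)" using PiE_mem[OF Lu(2)[unfolded U_def], of i] i Suc by simp
      then have "real (u i) \<le> 2 ^ (e i - e l)" by (simp add: less_imp_le)
      then have "real (u i) * norm (\<beta> L l) \<le> 2 ^ (e i - e l) * 2 ^ (e l + 1)"
        using \<beta>(3)[OF Lu(1) l] by (intro mult_mono) auto
      \<comment> \<open>Monotonicity of \<open>e\<close> makes the natural subtraction
        \<open>e i - e l\<close> exact.\<close>
      also have "\<dots> = 2 * 2 ^ e i" using mono[of l] Suc i by (simp flip: power_add)
      finally have "norm (\<beta> L i) + norm (real (u i) *\<^sub>R \<beta> L l) \<le> 4 * 2 ^ e i"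
        using \<beta>(3)[OF Lu(1) i] by simp
      then have "norm (shear u (\<beta> L) i) \<le> 4 * 2 ^ e i"
        using norm_triangle_ineq[of "\<beta> L i" "real (u i) *\<^sub>R \<beta> L l"] Suc by (simp add: shear_def)
      moreover have "shear u (\<beta> L) i \<in> int_vecs" using int Suc by (auto simp: shear_def int_vecs_def)
      ultimately show ?thesis by blast
    qed
    then show "y \<in> T" by (auto simp: y T_def)
  qed
  \<comment> \<open>The sheared basis spans \<open>L\<close> and so determines \<open>L\<close> and
    its chosen basis \<open>\<beta> L\<close>; then \<open>u i\<close> can be read off since the
    preceding basis vector is nonzero.\<close>
  have inj: "inj_on g (\<L> \<times> U)"
  proof (rule inj_onI)
    fix p p' assume p: "p \<in> \<L> \<times> U" "p' \<in> \<L> \<times> U" "g p = g p'"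
    obtain L u L' u' where pp: "p = (L, u)" "p' = (L', u')" by (cases p, cases p')
    have *: "shear u (\<beta> L) i = shear u' (\<beta> L') i" if "i < j" for i
      using fun_cong[OF p(3), of i] that by (simp add: g_def pp)
    have "zspan j (shear u (\<beta> L)) = zspan j (shear u' (\<beta> L'))" by (rule zspan_cong) (rule *)
    then have L: "L = L'" using \<beta>(1)[of L] \<beta>(1)[of L'] p pp by (simp add: zspan_shear)
    have "u i = u' i" if "i \<in> {1..<j}" for i
    proof -
      have "i < j" "i - 1 < j" "i \<noteq> 0" using that by auto
      with *[of i] nz[of L "i - 1"] L p pp show ?thesis by (simp add: shear_def)
    qed
    then have "u = u'" using p pp by (intro PiE_ext[of u "{1..<j}" _ u']) (auto simp: U_def)
    with L pp show "p = p'" by simp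
  qed
  have "finite (\<L> \<times> U)" by (rule inj_on_finite[OF inj gT finT])
  moreover have "U \<noteq> {}" by (auto simp: U_def PiE_eq_empty_iff lessThan_empty_iff)
  ultimately show "finite (lattices_of_profile K j e :: (real ^ 'd) set set)"
    unfolding \<L>_def[symmetric] by (rule finite_cartesian_productD1)
  have "card \<L> * card U \<le> card T"
    using card_inj_on_le[OF inj gT finT] by (simp add: card_cartesian_product)
  moreover have "card U = (\<Prod>i=1..<j. 2 ^ (e i - e (i - 1)))" unfolding U_def by (simp add: card_PiE)
  ultimately have "real (card \<L> * (\<Prod>i=1..<j. 2 ^ (e i - e (i - 1)))) \<le> real (card T)" by (simp only: of_nat_le_iff)
  also have "real (card T) = (\<Prod>i<j. real (card {z \<in> (int_vecs :: (real ^ 'd) set). norm z \<le> 4 * 2 ^ e i}))"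
    unfolding T_def by (simp add: card_PiE)
  also have "\<dots> \<le> (\<Prod>i<j. (3 * (4 * 2 ^ e i)) ^ CARD('d))"
  proof (intro prod_mono conjI card_int_vecs_ball)
    fix i show "(1::real) \<le> 4 * 2 ^ e i" using one_le_power[of "2::real" "e i"] by linarith
  qed auto
  finally show "real (card (lattices_of_profile K j e :: (real ^ 'd) set set)) * (\<Prod>i=1..<j. 2 ^ (e i - e (i - 1)))
        \<le> (\<Prod>i<j. (12 * 2 ^ e i) ^ CARD('d))"
    by (simp add: \<L>_def)
qed

section \<open>Tuples of given rank sorted by dyadic profile\<close>

definition profiles :: "nat \<Rightarrow> nat \<Rightarrow> (nat \<Rightarrow> nat) set" where
  "profiles j E = {e \<in> PiE {..<j} (\<lambda>_. {..E}). \<forall>i. Suc i < j \<longrightarrow> e i \<le> e (Suc i)}"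

lemma finite_profiles: "finite (profiles j E)"
  unfolding profiles_def by (rule finite_subset[of _ "PiE {..<j} (\<lambda>_. {..E})"]) (auto intro: finite_PiE)

definition tuples_of_rank :: "nat \<Rightarrow> real \<Rightarrow> nat \<Rightarrow> (real ^ 'd::finite) list set" where
  "tuples_of_rank m N j =
     {M. length M = m \<and> set M \<subseteq> int_vecs \<and> (\<forall>v\<in>set M. norm v \<le> N) \<and> dim (set M) = j}"

lemma ex_dyadic:
  assumes "1 \<le> (x::real)"
  shows "\<exists>e. 2 ^ e \<le> x \<and> x < 2 ^ (e + 1)"
proof -
  obtain n where n: "x < 2 ^ n" using real_arch_pow[of 2 x] by auto
  define k where "k = (LEAST k. x < 2 ^ k)"
  have k: "x < 2 ^ k" unfolding k_def by (rule LeastI[of "\<lambda>k. x < 2 ^ k", OF n])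
  then have "k \<noteq> 0" using assms by (cases k) auto
  then have "\<not> x < 2 ^ (k - 1)" unfolding k_def by (intro not_less_Least) simp
  with k \<open>k \<noteq> 0\<close> show ?thesis by (intro exI[of _ "k - 1"]) auto
qed

text \<open>Sort each tuple by the lattice of a reduced basis for its entries and by the dyadic
  sizes of that basis. The condition \<open>2 ^ e i \<le> N\<close> keeps a trace of
  \<open>norm (b i) \<le> N\<close>.\<close>

lemma tuples_of_rank_subset:
  assumes D: "\<And>V :: (real ^ 'd::finite) set. V \<subseteq> int_vecs \<Longrightarrow> (\<forall>v\<in>V. norm v \<le> N) \<Longrightarrow> dim V = j \<Longrightarrow>
       \<exists>b. norm_reduced K j b \<and> (\<forall>i<j. norm (b i) \<le> N) \<and> (\<forall>v\<in>V. real D *\<^sub>R v \<in> zspan j b)"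
    and E: "N < 2 ^ (E + 1)"
  shows "(tuples_of_rank m N j :: (real ^ 'd) list set) \<subseteq>
    (\<Union>e\<in>{e\<in>profiles j E. \<forall>i<j. 2 ^ e i \<le> N}. \<Union>L\<in>lattices_of_profile K j e.
       {M. set M \<subseteq> {v. norm v \<le> N \<and> real D *\<^sub>R v \<in> L} \<and> length M = m})"
proof
  fix M :: "(real ^ 'd) list" assume M: "M \<in> tuples_of_rank m N j"
  then obtain b where b: "norm_reduced K j b" "\<And>i. i < j \<Longrightarrow> norm (b i) \<le> N" "\<And>v. v \<in> set M \<Longrightarrow> real D *\<^sub>R v \<in> zspan j b"
    using D[of "set M"] unfolding tuples_of_rank_def by blast
  have "\<forall>i\<in>{..<j}. \<exists>e. 2 ^ e \<le> norm (b i) \<and> norm (b i) < 2 ^ (e + 1)"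
  proof
    fix i assume "i \<in> {..<j}"
    then have "b i \<in> int_vecs" "b i \<noteq> 0" using b(1) unfolding norm_reduced_def by auto
    then show "\<exists>e. 2 ^ e \<le> norm (b i) \<and> norm (b i) < 2 ^ (e + 1)"
      by (intro ex_dyadic int_vecs_norm_ge_1)
  qed
  then obtain e' where e': "\<And>i. i < j \<Longrightarrow> 2 ^ e' i \<le> norm (b i) \<and> norm (b i) < 2 ^ (e' i + 1)" by (metis lessThan_iff)
  define e where "e = restrict e' {..<j}"
  have e: "2 ^ e i \<le> norm (b i)" "norm (b i) < 2 ^ (e i + 1)" if "i < j" for i using e'[OF that] that by (auto simp: e_def)
  have eN: "2 ^ e i \<le> N" if "i < j" for i using e(1)[OF that] b(2)[OF that] by simp
  have "e \<in> profiles j E" unfolding profiles_def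
  proof (intro CollectI conjI allI impI)
    show "e \<in> PiE {..<j} (\<lambda>_. {..E})"
    proof (rule PiE_I)
      fix i assume "i \<in> {..<j}"
      then have "(2::real) ^ e i < 2 ^ (E + 1)" using eN[of i] E by simp
      then have "e i < E + 1" by (rule power_less_imp_less_exp[rotated]) simp
      then show "e i \<in> {..E}" by simp
    qed (auto simp: e_def)
    fix i assume i: "Suc i < j"
    have "norm (b i) \<le> norm (b (Suc i))" using b(1) i unfolding norm_reduced_def by auto
    then have "(2::real) ^ e i < 2 ^ (e (Suc i) + 1)" using e[of i] e[of "Suc i"] i by linarith
    then have "e i < e (Suc i) + 1" by (rule power_less_imp_less_exp[rotated]) simp
    then show "e i \<le> e (Suc i)" by simp
  qed
  moreover have "zspan j b \<in> lattices_of_profile K j e"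
    unfolding lattices_of_profile_def using b(1) e by blast
  moreover have "set M \<subseteq> {v. norm v \<le> N \<and> real D *\<^sub>R v \<in> zspan j b}" "length M = m"
    using M b(3) by (auto simp: tuples_of_rank_def)
  ultimately show "M \<in> (\<Union>e\<in>{e\<in>profiles j E. \<forall>i<j. 2 ^ e i \<le> N}. \<Union>L\<in>lattices_of_profile K j e.
       {M. set M \<subseteq> {v. norm v \<le> N \<and> real D *\<^sub>R v \<in> L} \<and> length M = m})"
    using eN by blast
qed

text \<open>The profile-dependent part of the number of lattices times the number of tuples in each.
  A quotient of powers is used since \<open>m\<close> may exceed \<open>d\<close>.\<close>

definition weight :: "nat \<Rightarrow> nat \<Rightarrow> nat \<Rightarrow> (nat \<Rightarrow> nat) \<Rightarrow> real" where
  "weight d m j e = (\<Prod>i<j. (2 ^ e i) ^ d / (2 ^ e i) ^ m) / (\<Prod>i=1..<j. 2 ^ (e i - e (i - 1)))"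

lemma weight_nonneg: "weight d m j e \<ge> 0"
  unfolding weight_def by (intro divide_nonneg_nonneg prod_nonneg) auto

text \<open>A union bound over profiles and lattices: the power of \<open>N\<close> and the
  constants are the same for every profile and come out of the sum.\<close>

lemma
  assumes D: "\<And>V :: (real ^ 'd::finite) set. V \<subseteq> int_vecs \<Longrightarrow> (\<forall>v\<in>V. norm v \<le> N) \<Longrightarrow> dim V = j \<Longrightarrow>
       \<exists>b. norm_reduced K j b \<and> (\<forall>i<j. norm (b i) \<le> N) \<and> (\<forall>v\<in>V. real D *\<^sub>R v \<in> zspan j b)"
    and K: "1 \<le> K" "0 < D" and E: "N < 2 ^ (E + 1)" and N: "0 \<le> N"
  shows finite_tuples_of_rank: "finite (tuples_of_rank m N j :: (real ^ 'd) list set)"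
    and card_tuples_of_rank_le: "real (card (tuples_of_rank m N j :: (real ^ 'd) list set)) \<le>
      (12 ^ CARD('d) * (6 * K * real D * N) ^ m) ^ j * (\<Sum>e\<in>profiles j E. weight CARD('d) m j e)"
proof -
  let ?P = "{e\<in>profiles j E. \<forall>i<j. 2 ^ e i \<le> N}"
  let ?F = "\<lambda>L :: (real ^ 'd) set. {M. set M \<subseteq> {v. norm v \<le> N \<and> real D *\<^sub>R v \<in> L} \<and> length M = m}"
  define G where "G e = (\<Prod>i<j. 6 * K * real D * N / 2 ^ e i) ^ m" for e :: "nat \<Rightarrow> nat"
  have finP: "finite ?P" using finite_profiles by (rule finite_subset[rotated]) auto
  have finL: "finite (lattices_of_profile K j e :: (real ^ 'd) set set)" if "e \<in> ?P" for e
    using that by (intro finite_lattices_of_profile) (auto simp: profiles_def)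
  have F: "finite (?F L) \<and> real (card (?F L)) \<le> G e"
    if L: "L \<in> lattices_of_profile K j e" and e: "e \<in> ?P" for L e
  proof -
    obtain b where b: "norm_reduced K j b" "\<And>i. i < j \<Longrightarrow> 2 ^ e i \<le> norm (b i)" "\<And>i. i < j \<Longrightarrow> norm (b i) < 2 ^ (e i + 1)" "L = zspan j b"
      using L unfolding lattices_of_profile_def by blast
    \<comment> \<open>A lattice of the profile may come with a basis other than the one bounded by
      \<open>N\<close>; the profile still bounds that basis by \<open>2 * N\<close>, so the count
      runs over the larger ball.\<close>
    have bN: "norm (b i) \<le> 2 * N" if "i < j" for i
    proof -
      have "2 ^ e i \<le> N" using e that by blast
      then show ?thesis using b(3)[OF that] by simp
    qed
    let ?S = "{v. norm v \<le> N \<and> real D *\<^sub>R v \<in> L}"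
    let ?S' = "{v. norm v \<le> 2 * N \<and> real D *\<^sub>R v \<in> zspan j b}"
    have sub: "?S \<subseteq> ?S'" using N b(4) by auto
    have finS': "finite ?S'" by (rule finite_zspan_multiples[OF b(1) K bN])
    then have finS: "finite ?S" by (rule finite_subset[OF sub])
    have "real (card ?S) \<le> real (card ?S')" using card_mono[OF finS' sub] by simp
    also have "\<dots> \<le> (\<Prod>i<j. 3 * (K * real D * (2 * N) / norm (b i)))"
      by (rule card_zspan_multiples[OF b(1) K bN])
    also have "\<dots> \<le> (\<Prod>i<j. 6 * K * real D * N / 2 ^ e i)"
    proof (intro prod_mono conjI)
      fix i assume "i \<in> {..<j}"
      then have i: "i < j" by simp
      show "0 \<le> 3 * (K * real D * (2 * N) / norm (b i))" using K N by simp
      have pos: "0 < (2::real) ^ e i" by simp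
      have "3 * (K * real D * (2 * N) / norm (b i)) = 6 * K * real D * N / norm (b i)" by simp
      also have "\<dots> \<le> 6 * K * real D * N / 2 ^ e i"
        by (rule divide_left_mono[OF b(2)[OF i]])
          (use K N pos order_less_le_trans[OF pos b(2)[OF i]] in auto)
      finally show "3 * (K * real D * (2 * N) / norm (b i)) \<le> 6 * K * real D * N / 2 ^ e i" .
    qed
    finally have *: "real (card ?S) ^ m \<le> G e" unfolding G_def by (intro power_mono) auto
    have "finite (?F L)" by (rule finite_lists_length_eq[OF finS])
    moreover have "card (?F L) = card ?S ^ m" by (rule card_lists_length_eq[OF finS])
    ultimately show ?thesis using * by simp
  qed
  have sub: "(tuples_of_rank m N j :: (real ^ 'd) list set) \<subseteq> (\<Union>e\<in>?P. \<Union>L\<in>lattices_of_profile K j e. ?F L)"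
    by (rule tuples_of_rank_subset[OF _ E]) (rule D)
  have fin1: "finite (\<Union>L\<in>lattices_of_profile K j e. ?F L)" if "e \<in> ?P" for e
    using F[OF _ that] finL[OF that] by blast
  then have fin2: "finite (\<Union>e\<in>?P. \<Union>L\<in>lattices_of_profile K j e. ?F L)"
    using finP by blast
  then show "finite (tuples_of_rank m N j :: (real ^ 'd) list set)"
    by (rule finite_subset[OF sub])
  have "card (tuples_of_rank m N j :: (real ^ 'd) list set) \<le> card (\<Union>e\<in>?P. \<Union>L\<in>lattices_of_profile K j e. ?F L)"
    by (rule card_mono[OF fin2 sub])
  also have "\<dots> \<le> (\<Sum>e\<in>?P. \<Sum>L\<in>lattices_of_profile K j e. card (?F L))"
    using finP finL by (intro order_trans[OF card_UN_le] sum_mono card_UN_le) auto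
  finally have "real (card (tuples_of_rank m N j :: (real ^ 'd) list set)) \<le>
      real (\<Sum>e\<in>?P. \<Sum>L\<in>lattices_of_profile K j e. card (?F L))" by (subst of_nat_le_iff)
  also have "\<dots> = (\<Sum>e\<in>?P. \<Sum>L\<in>lattices_of_profile K j e. real (card (?F L)))" by simp
  also have "\<dots> \<le> (\<Sum>e\<in>?P. \<Sum>L\<in>(lattices_of_profile K j e :: (real ^ 'd) set set). G e)"
    using F by (intro sum_mono) blast
  also have "\<dots> \<le> (\<Sum>e\<in>?P. (12 ^ CARD('d) * (6 * K * real D * N) ^ m) ^ j * weight CARD('d) m j e)"
  proof (rule sum_mono)
    fix e assume e: "e \<in> ?P"
    let ?c = "real (card (lattices_of_profile K j e :: (real ^ 'd) set set))"
    have pos: "0 < (\<Prod>i=1..<j. (2::real) ^ (e i - e (i - 1)))" by (intro prod_pos) auto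
    have "?c * (\<Prod>i=1..<j. 2 ^ (e i - e (i - 1))) \<le> (\<Prod>i<j. (12 * 2 ^ e i) ^ CARD('d))"
      using e by (intro card_lattices_of_profile) (auto simp: profiles_def)
    then have c: "?c \<le> (\<Prod>i<j. (12 * 2 ^ e i) ^ CARD('d)) / (\<Prod>i=1..<j. 2 ^ (e i - e (i - 1)))"
      using pos by (simp add: field_simps)
    have "G e \<ge> 0" unfolding G_def using K N by (intro zero_le_power prod_nonneg) auto
    have "(\<Sum>L\<in>(lattices_of_profile K j e :: (real ^ 'd) set set). G e) = ?c * G e" by simp
    also have "\<dots> \<le> (\<Prod>i<j. (12 * 2 ^ e i) ^ CARD('d)) / (\<Prod>i=1..<j. 2 ^ (e i - e (i - 1))) * G e"
      by (rule mult_right_mono[OF c \<open>G e \<ge> 0\<close>])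
    also have "\<dots> = (\<Prod>i<j. (12 * 2 ^ e i) ^ CARD('d) * (6 * K * real D * N / 2 ^ e i) ^ m) / (\<Prod>i=1..<j. 2 ^ (e i - e (i - 1)))"
      by (simp add: G_def prod.distrib prod_power_distrib)
    also have "(\<Prod>i<j. (12 * 2 ^ e i) ^ CARD('d) * (6 * K * real D * N / 2 ^ e i) ^ m) =
      (\<Prod>i<j. (12 ^ CARD('d) * (6 * K * real D * N) ^ m) * ((2 ^ e i) ^ CARD('d) / (2 ^ e i) ^ m))"
      by (intro prod.cong refl) (simp add: power_mult_distrib power_divide)
    also have "\<dots> = (12 ^ CARD('d) * (6 * K * real D * N) ^ m) ^ j * (\<Prod>i<j. (2 ^ e i) ^ CARD('d) / (2 ^ e i) ^ m)"
    proof -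
      have "(\<Prod>i<j. c * f i) = c ^ j * prod f {..<j}" for c :: real and f
        by (simp add: prod.distrib)
      then show ?thesis .
    qed
    finally show "(\<Sum>L\<in>(lattices_of_profile K j e :: (real ^ 'd) set set). G e) \<le>
      (12 ^ CARD('d) * (6 * K * real D * N) ^ m) ^ j * weight CARD('d) m j e"
      by (simp add: weight_def)
  qed
  also have "\<dots> = (12 ^ CARD('d) * (6 * K * real D * N) ^ m) ^ j * (\<Sum>e\<in>?P. weight CARD('d) m j e)"
    by (simp add: sum_distrib_left)
  also have "\<dots> \<le> (12 ^ CARD('d) * (6 * K * real D * N) ^ m) ^ j * (\<Sum>e\<in>profiles j E. weight CARD('d) m j e)"
    using K N finite_profiles weight_nonneg by (intro mult_left_mono sum_mono2) auto
  finally show "real (card (tuples_of_rank m N j :: (real ^ 'd) list set)) \<le>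
      (12 ^ CARD('d) * (6 * K * real D * N) ^ m) ^ j * (\<Sum>e\<in>profiles j E. weight CARD('d) m j e)" .
qed

section \<open>Summation over dyadic profiles\<close>

lemma sum_dyadic_powers:
  assumes "s \<ge> 1"
  shows "(\<Sum>t\<le>E. ((2::real) ^ t) ^ s) \<le> 2 * (2 ^ E) ^ s"
proof (induction E)
  case (Suc E)
  have "2 * ((2::real) ^ E) ^ s \<le> 2 ^ s * (2 ^ E) ^ s"
    using power_increasing[of 1 s "2::real"] assms by (intro mult_right_mono) auto
  also have "\<dots> = (2 ^ Suc E) ^ s" by (simp add: power_mult_distrib)
  finally have "2 * ((2::real) ^ E) ^ s \<le> (2 ^ Suc E) ^ s" .
  then show ?case unfolding sum.atMost_Suc using Suc.IH by linarith
qed simp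

lemma sum_half_powers: "(\<Sum>t\<le>E. 1 / (2::real) ^ t) \<le> 2"
proof -
  have "(\<Sum>t\<le>E. 1 / (2::real) ^ t) = 2 - 1 / 2 ^ E"
    by (induction E) (auto simp: field_simps)
  then show ?thesis by simp
qed

text \<open>Away from the critical exponent the gaps between scales may be discarded, since their
  product is at least 1. Summing over all functions instead of the monotone ones then factors into
  \<open>j\<close> one-dimensional sums.\<close>

lemma sum_weight_le_power:
  assumes "\<And>t. t \<le> E \<Longrightarrow> ((2::real) ^ t) ^ d / (2 ^ t) ^ m \<le> h t" "(\<Sum>t\<le>E. h t) \<le> B"
  shows "(\<Sum>e\<in>profiles j E. weight d m j e) \<le> B ^ j"
proof -
  have h0: "h t \<ge> 0" if "t \<le> E" for t by (rule order_trans[OF _ assms(1)[OF that]]) simp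
  have "(\<Sum>e\<in>profiles j E. weight d m j e) \<le> (\<Sum>e\<in>profiles j E. \<Prod>i<j. h (e i))"
  proof (rule sum_mono)
    fix e assume e: "e \<in> profiles j E"
    have eE: "e i \<le> E" if "i < j" for i using e that unfolding profiles_def by (auto dest: PiE_mem)
    have "1 \<le> (\<Prod>i=1..<j. (2::real) ^ (e i - e (i - 1)))" by (intro prod_ge_1) auto
    then have "weight d m j e \<le> (\<Prod>i<j. (2 ^ e i) ^ d / (2 ^ e i) ^ m) / 1"
      unfolding weight_def by (intro divide_left_mono prod_nonneg mult_pos_pos) auto
    also have "\<dots> \<le> (\<Prod>i<j. h (e i))" unfolding div_by_1
      by (intro prod_mono conjI) (auto intro!: assms(1) eE)
    finally show "weight d m j e \<le> (\<Prod>i<j. h (e i))" .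
  qed
  also have "\<dots> \<le> (\<Sum>e\<in>PiE {..<j} (\<lambda>_. {..E}). \<Prod>i<j. h (e i))"
    by (intro sum_mono2 finite_PiE prod_nonneg h0) (auto simp: profiles_def dest: PiE_mem)
  also have "\<dots> = (\<Prod>i<j. \<Sum>t\<le>E. h t)"
    by (rule prod_sum_PiE[symmetric]) auto
  also have "\<dots> = (\<Sum>t\<le>E. h t) ^ j" by simp
  also have "\<dots> \<le> B ^ j"
    using assms(2) h0 by (intro power_mono sum_nonneg) auto
  finally show ?thesis .
qed

text \<open>In the critical case only the gaps between consecutive scales carry a weight, so that the
  smallest scale is free and contributes the number \<open>E + 1\<close> of scales.\<close>

lemma sum_weight_critical:
  "(\<Sum>e\<in>profiles j E. weight d d j e) \<le> 2 ^ j * (real E + 1)"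
proof (cases "j = 0")
  case True
  then show ?thesis by (simp add: profiles_def weight_def)
next
  case False
  define h where "h i t = (if i = 0 then 1 else 1 / (2::real) ^ t)" for i t :: nat
  \<comment> \<open>Pass to the smallest scale and the successive gaps; on monotone profiles this
    loses nothing, and the weight becomes a product over independent coordinates.\<close>
  define \<phi> where "\<phi> e = restrict (\<lambda>i. if i = 0 then e 0 else e i - e (i - 1)) {..<j}" for e :: "nat \<Rightarrow> nat"
  have w: "weight d d j e = (\<Prod>i<j. h i (\<phi> e i))" for e
  proof -
    have "(\<Prod>i<j. h i (\<phi> e i)) = (\<Prod>i=1..<j. h i (\<phi> e i))"
      by (rule prod.mono_neutral_right) (auto simp: h_def)
    also have "\<dots> = (\<Prod>i=1..<j. 1 / 2 ^ (e i - e (i - 1)))"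
      by (intro prod.cong) (auto simp: h_def \<phi>_def)
    also have "\<dots> = weight d d j e" by (simp add: weight_def prod_dividef)
    finally show ?thesis ..
  qed
  have inj: "inj_on \<phi> (profiles j E)"
  proof (rule inj_onI)
    fix e e' assume e: "e \<in> profiles j E" "e' \<in> profiles j E" "\<phi> e = \<phi> e'"
    have "e i = e' i" if "i < j" for i
      using that
    proof (induction i)
      case 0
      then show ?case using fun_cong[OF e(3), of 0] by (simp add: \<phi>_def)
    next
      case (Suc i)
      have "e i \<le> e (Suc i)" "e' i \<le> e' (Suc i)" using e(1,2) Suc.prems unfolding profiles_def by auto
      then show ?case using Suc fun_cong[OF e(3), of "Suc i"] by (simp add: \<phi>_def)
    qed
    then show "e = e'" using e by (intro PiE_ext[of e "{..<j}" "\<lambda>_. {..E}" e']) (auto simp: profiles_def)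
  qed
  have img: "\<phi> ` profiles j E \<subseteq> PiE {..<j} (\<lambda>_. {..E})"
  proof
    fix f assume "f \<in> \<phi> ` profiles j E"
    then obtain e where e: "e \<in> profiles j E" "f = \<phi> e" by blast
    have eE: "e i \<le> E" if "i < j" for i using e that unfolding profiles_def by (auto dest: PiE_mem)
    show "f \<in> PiE {..<j} (\<lambda>_. {..E})" unfolding e(2)
    proof (rule PiE_I)
      fix i assume "i \<in> {..<j}"
      then show "\<phi> e i \<in> {..E}" using eE[of i] by (auto simp: \<phi>_def)
    qed (auto simp: \<phi>_def)
  qed
  have "(\<Sum>e\<in>profiles j E. weight d d j e) = (\<Sum>f\<in>\<phi> ` profiles j E. \<Prod>i<j. h i (f i))"
    by (simp add: sum.reindex[OF inj] w)
  also have "\<dots> \<le> (\<Sum>f\<in>PiE {..<j} (\<lambda>_. {..E}). \<Prod>i<j. h i (f i))"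
    by (rule sum_mono2[OF _ img]) (auto intro!: finite_PiE prod_nonneg simp: h_def)
  also have "\<dots> = (\<Prod>i<j. \<Sum>t\<le>E. h i t)"
    by (rule prod_sum_PiE[symmetric]) auto
  also have "\<dots> \<le> (\<Prod>i<j. if i = 0 then real E + 1 else 2)"
    using sum_half_powers by (intro prod_mono conjI) (auto simp: h_def intro!: sum_nonneg)
  also have "\<dots> = (real E + 1) * 2 ^ (j - 1)"
  proof -
    have "{..<j} = insert 0 {1..<j}" using False by auto
    then show ?thesis by simp
  qed
  also have "\<dots> \<le> (real E + 1) * 2 ^ j" by (intro mult_left_mono power_increasing) auto
  finally show ?thesis by (simp add: mult.commute)
qed

text \<open>For \<open>m < d\<close> the largest scale dominates, for \<open>m > d\<close> the
  smallest. The truncated \<open>d - m\<close> makes the power of \<open>N\<close> disappear when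
  \<open>m \<ge> d\<close>.\<close>

lemma sum_weight:
  assumes "2 ^ E \<le> N"
  shows "(\<Sum>e\<in>profiles j E. weight d m j e) \<le>
    2 ^ j * (N ^ (d - m)) ^ j * (if m = d then real E + 1 else 1)"
proof -
  consider "m = d" | "m < d" | "d < m" by linarith
  then show ?thesis
  proof cases
    case 1
    then show ?thesis using sum_weight_critical[of d j E] by simp
  next
    case 2
    have "(\<Sum>e\<in>profiles j E. weight d m j e) \<le> (2 * N ^ (d - m)) ^ j"
    proof (rule sum_weight_le_power)
      show "((2::real) ^ t) ^ d / (2 ^ t) ^ m \<le> (2 ^ t) ^ (d - m)" for t
        using 2 by (simp add: power_diff)
      have "(\<Sum>t\<le>E. ((2::real) ^ t) ^ (d - m)) \<le> 2 * (2 ^ E) ^ (d - m)"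
        using 2 by (intro sum_dyadic_powers) auto
      also have "\<dots> \<le> 2 * N ^ (d - m)" using assms by (intro mult_left_mono power_mono) auto
      finally show "(\<Sum>t\<le>E. ((2::real) ^ t) ^ (d - m)) \<le> 2 * N ^ (d - m)" .
    qed
    with 2 show ?thesis by (simp add: power_mult_distrib)
  next
    case 3
    have "(\<Sum>e\<in>profiles j E. weight d m j e) \<le> 2 ^ j"
    proof (rule sum_weight_le_power[OF _ sum_half_powers])
      fix t
      have "((2::real) ^ t) ^ d * 2 ^ t = (2 ^ t) ^ Suc d" by simp
      also have "\<dots> \<le> (2 ^ t) ^ m" using 3 by (intro power_increasing) auto
      finally show "((2::real) ^ t) ^ d / (2 ^ t) ^ m \<le> 1 / 2 ^ t" by (simp add: divide_simps)
    qed
    with 3 show ?thesis by simp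
  qed
qed

section \<open>The upper bound\<close>

lemma card_tuples_of_rank:
  "\<exists>C. \<forall>N\<ge>1. finite (tuples_of_rank m N j :: (real ^ 'd::finite) list set) \<and>
     real (card (tuples_of_rank m N j :: (real ^ 'd) list set)) \<le>
       C * N ^ (j * max m CARD('d)) * (if m = CARD('d) then log 2 N + 1 else 1)"
proof -
  let ?d = "CARD('d)"
  obtain K D where KD: "1 \<le> K" "0 < D" and b: "\<And>N V. (V :: (real ^ 'd) set) \<subseteq> int_vecs \<Longrightarrow> (\<forall>v\<in>V. norm v \<le> N) \<Longrightarrow> dim V = j \<Longrightarrow>
       \<exists>b. norm_reduced K j b \<and> (\<forall>i<j. norm (b i) \<le> N) \<and> (\<forall>v\<in>V. real D *\<^sub>R v \<in> zspan j b)"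
    using norm_reduced_exists[of j] by blast
  define C where "C = (2 * 12 ^ ?d * (6 * K * real D) ^ m) ^ j"
  have C0: "C \<ge> 0" unfolding C_def using KD by simp
  show ?thesis
  proof (intro exI[of _ C] allI impI)
    fix N :: real assume N: "N \<ge> 1"
    obtain E where E: "2 ^ E \<le> N" "N < 2 ^ (E + 1)" using ex_dyadic[OF N] by blast
    have N0: "0 \<le> N" using N by simp
    have fin: "finite (tuples_of_rank m N j :: (real ^ 'd) list set)"
      by (rule finite_tuples_of_rank[OF b KD E(2) N0])
    have Elog: "real E \<le> log 2 N" using E(1) N by (simp add: le_log_iff powr_realpow)
    have "real (card (tuples_of_rank m N j :: (real ^ 'd) list set)) \<le>
      (12 ^ ?d * (6 * K * real D * N) ^ m) ^ j * (\<Sum>e\<in>profiles j E. weight ?d m j e)"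
      by (rule card_tuples_of_rank_le[OF b KD E(2) N0])
    also have "\<dots> \<le> (12 ^ ?d * (6 * K * real D * N) ^ m) ^ j *
        (2 ^ j * (N ^ (?d - m)) ^ j * (if m = ?d then real E + 1 else 1))"
      using KD N by (intro mult_left_mono sum_weight E) auto
    also have "\<dots> = C * (N ^ m * N ^ (?d - m)) ^ j * (if m = ?d then real E + 1 else 1)"
      by (simp add: C_def power_mult_distrib)
    \<comment> \<open>With truncated subtraction, \<open>m + (?d - m)\<close> is the maximum of
      \<open>m\<close> and \<open>?d\<close>.\<close>
    also have "(N ^ m * N ^ (?d - m)) ^ j = N ^ (j * max m ?d)"
      by (simp flip: power_add power_mult add: mult.commute max_def)
    also have "C * N ^ (j * max m ?d) * (if m = ?d then real E + 1 else 1) \<le>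
        C * N ^ (j * max m ?d) * (if m = ?d then log 2 N + 1 else 1)"
      using Elog C0 N by (intro mult_left_mono mult_nonneg_nonneg) auto
    finally show "finite (tuples_of_rank m N j :: (real ^ 'd::finite) list set) \<and>
       real (card (tuples_of_rank m N j :: (real ^ 'd) list set)) \<le>
       C * N ^ (j * max m ?d) * (if m = ?d then log 2 N + 1 else 1)" using fin by blast
  qed
qed

lemma card_tuples_of_rank_le_k:
  "\<exists>C. \<forall>N\<ge>1. finite (\<Union>j\<le>k. tuples_of_rank m N j :: (real ^ 'd::finite) list set) \<and>
     real (card (\<Union>j\<le>k. tuples_of_rank m N j :: (real ^ 'd) list set)) \<le>
       C * N ^ (k * max m CARD('d)) * (if m = CARD('d) then log 2 N + 1 else 1)"
proof -
  let ?d = "CARD('d)"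
  let ?T = "\<lambda>N j. tuples_of_rank m N j :: (real ^ 'd) list set"
  define l where "l N = (if m = ?d then log 2 N + 1 else 1)" for N
  obtain C where C: "\<And>j N. N \<ge> 1 \<Longrightarrow> finite (?T N j)" "\<And>j N. N \<ge> 1 \<Longrightarrow>
     real (card (?T N j)) \<le> C j * N ^ (j * max m ?d) * l N"
    using card_tuples_of_rank[where 'd='d] unfolding l_def by metis
  show ?thesis
  proof (intro exI[of _ "\<Sum>j\<le>k. \<bar>C j\<bar>"] allI impI conjI)
    fix N :: real assume N: "N \<ge> 1"
    have l0: "l N \<ge> 0" using N by (simp add: l_def)
    show "finite (\<Union>j\<le>k. ?T N j)" using C(1)[OF N] by auto
    have "real (card (\<Union>j\<le>k. ?T N j)) \<le> real (\<Sum>j\<le>k. card (?T N j))"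
      by (subst of_nat_le_iff, rule card_UN_le) simp
    also have "\<dots> = (\<Sum>j\<le>k. real (card (?T N j)))" by simp
    also have "\<dots> \<le> (\<Sum>j\<le>k. \<bar>C j\<bar> * N ^ (k * max m ?d) * l N)"
    proof (rule sum_mono)
      fix j assume "j \<in> {..k}"
      have "real (card (?T N j)) \<le> C j * N ^ (j * max m ?d) * l N" by (rule C(2)[OF N])
      also have "\<dots> \<le> \<bar>C j\<bar> * N ^ (k * max m ?d) * l N"
        using N \<open>j \<in> {..k}\<close> l0 by (intro mult_right_mono mult_mono power_increasing) auto
      finally show "real (card (?T N j)) \<le> \<bar>C j\<bar> * N ^ (k * max m ?d) * l N" .
    qed
    also have "\<dots> = (\<Sum>j\<le>k. \<bar>C j\<bar>) * N ^ (k * max m ?d) * l N" by (simp add: sum_distrib_right)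
    finally show "real (card (\<Union>j\<le>k. ?T N j)) \<le>
      (\<Sum>j\<le>k. \<bar>C j\<bar>) * N ^ (k * max m ?d) * (if m = ?d then log 2 N + 1 else 1)" by (simp only: l_def)
  qed
qed

lemma
  shows finite_grid: "finite (grid n :: (real ^ 'd::finite) set)"
    and card_grid: "card (grid n :: (real ^ 'd::finite) set) = n ^ CARD('d)"
proof -
  show "finite (grid n :: (real ^ 'd::finite) set)" unfolding grid_def by (rule finite_vec_components) simp
  have "card (real ` {1..n}) = n" by (subst card_image) auto
  then show "card (grid n :: (real ^ 'd::finite) set) = n ^ CARD('d)"
    unfolding grid_def by (subst card_vec_components) auto
qed

lemma grid_diff:
  assumes "p \<in> grid n" "q \<in> (grid n :: (real ^ 'd::finite) set)"
  shows "q - p \<in> int_vecs" "norm (q - p) \<le> real CARD('d) * real n"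
proof -
  have pq: "\<exists>a\<in>{1..n}. p $ i = real a" "\<exists>b\<in>{1..n}. q $ i = real b" for i
    using assms by (auto simp: grid_def)
  show "q - p \<in> int_vecs"
    unfolding int_vecs_def
  proof (intro CollectI allI)
    fix i show "(q - p) $ i \<in> \<int>" using pq[of i] by auto
  qed
  have "norm (q - p) \<le> (\<Sum>i\<in>UNIV. \<bar>(q - p) $ i\<bar>)" by (rule norm_le_l1_cart)
  also have "\<dots> \<le> (\<Sum>i\<in>(UNIV::'d set). real n)"
  proof (rule sum_mono)
    fix i show "\<bar>(q - p) $ i\<bar> \<le> real n" using pq[of i] by auto
  qed
  finally show "norm (q - p) \<le> real CARD('d) * real n" by simp
qed

text \<open>Moving \<open>p\<close> to the origin turns the flat \<open>S\<close> into a linear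
  space of dimension \<open>k\<close>; the differences may span less, hence the union over
  \<open>j\<close>.\<close>

lemma coflat_tuples_difference:
  assumes "p # qs \<in> (coflat_tuples n k (Suc m) :: (real ^ 'd::finite) list set)"
  shows "p \<in> grid n" "map (\<lambda>q. q - p) qs \<in> (\<Union>j\<le>k. tuples_of_rank m (real CARD('d) * real n) j)"
proof -
  obtain S where S: "affine S" "aff_dim S = int k" "insert p (set qs) \<subseteq> S"
    and qs: "length qs = m" "set qs \<subseteq> grid n" and p: "p \<in> grid n" using assms by (auto simp: coflat_tuples_def)
  show "p \<in> grid n" by (rule p)
  have "dim (set (map (\<lambda>q. q - p) qs)) \<le> dim ((\<lambda>x. x - p) ` S)"
    by (rule dim_subset) (use S in auto)
  also have "int \<dots> = aff_dim S" using S by (intro aff_dim_eq_dim_subtract[symmetric] hull_inc) auto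
  finally have "dim (set (map (\<lambda>q. q - p) qs)) \<le> k" using S by simp
  then show "map (\<lambda>q. q - p) qs \<in> (\<Union>j\<le>k. tuples_of_rank m (real CARD('d) * real n) j)"
    using qs grid_diff[OF p] by (auto simp: tuples_of_rank_def)
qed

lemma coflat_count_upper:
  assumes r: "0 < r"
  shows "\<exists>C. \<forall>n\<ge>2. real (coflat_count TYPE('d::finite) n k r) \<le> C * growth CARD('d) k r n"
proof -
  let ?d = "CARD('d)"
  obtain m where m: "r = Suc m" using r gr0_implies_Suc by blast
  obtain C where C: "\<And>N. N \<ge> 1 \<Longrightarrow> finite (\<Union>j\<le>k. tuples_of_rank m N j :: (real ^ 'd) list set)"
    "\<And>N. N \<ge> 1 \<Longrightarrow> real (card (\<Union>j\<le>k. tuples_of_rank m N j :: (real ^ 'd) list set)) \<le>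
       C * N ^ (k * max m ?d) * (if m = ?d then log 2 N + 1 else 1)"
    using card_tuples_of_rank_le_k[where 'd='d and m=m and k=k] by blast
  \<comment> \<open>Chosen so that \<open>log 2 N + 1 \<le> c * ln (real n)\<close>: for
    \<open>n \<ge> 2\<close> the constant terms do not shrink when multiplied by
    \<open>ln (real n) / ln 2\<close>.\<close>
  define c where "c = 2 / ln 2 + ln (real ?d) / (ln 2)^2"
  have d1: "real ?d \<ge> 1" by (simp add: Suc_leI)
  show ?thesis
  proof (intro exI[of _ "\<bar>C\<bar> * real ?d ^ (k * max m ?d) * (if m = ?d then c else 1)"] allI impI)
    fix n :: nat assume n: "n \<ge> 2"
    define N where "N = real ?d * real n"
    have N1: "N \<ge> 1" using mult_mono[of 1 "real ?d" 1 "real n"] n d1 by (simp add: N_def)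
    let ?T = "\<Union>j\<le>k. tuples_of_rank m N j :: (real ^ 'd) list set"
    let ?F = "\<lambda>ps :: (real ^ 'd) list. (hd ps, map (\<lambda>q. q - hd ps) (tl ps))"
    have "?F ` coflat_tuples n k r \<subseteq> grid n \<times> ?T"
    proof
      fix y assume "y \<in> ?F ` coflat_tuples n k r"
      then obtain ps where ps: "ps \<in> coflat_tuples n k r" "y = ?F ps" by blast
      then obtain p qs where "ps = p # qs" using m by (cases ps) (auto simp: coflat_tuples_def)
      with ps coflat_tuples_difference[of p qs n k m] show "y \<in> grid n \<times> ?T" by (simp add: m N_def)
    qed
    moreover have "inj_on ?F (coflat_tuples n k r)"
    proof (rule inj_onI)
      fix ps ps' assume ps: "ps \<in> coflat_tuples n k r" "ps' \<in> coflat_tuples n k r" "?F ps = ?F ps'"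
      obtain p qs p' qs' where "ps = p # qs" "ps' = p' # qs'" using ps m
        by (cases ps; cases ps') (auto simp: coflat_tuples_def)
      with ps(3) show "ps = ps'" by (auto simp: inj_map_eq_map inj_on_def)
    qed
    ultimately have "card (coflat_tuples n k r :: (real ^ 'd) list set) \<le> card ((grid n :: (real ^ 'd) set) \<times> ?T)"
      by (intro card_inj_on_le[where f = ?F] finite_cartesian_product finite_grid C(1)[OF N1])
    then have "coflat_count TYPE('d) n k r \<le> n ^ ?d * card ?T"
      by (simp add: coflat_count_def card_cartesian_product card_grid)
    then have "real (coflat_count TYPE('d) n k r) \<le> real n ^ ?d * real (card ?T)"
      by (metis of_nat_le_iff of_nat_mult of_nat_power)
    also have "\<dots> \<le> real n ^ ?d * (\<bar>C\<bar> * N ^ (k * max m ?d) * (if m = ?d then log 2 N + 1 else 1))"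
    proof (rule mult_left_mono)
      have "0 \<le> N ^ (k * max m ?d) * (if m = ?d then log 2 N + 1 else 1)" using N1 by simp
      then have "C * (N ^ (k * max m ?d) * (if m = ?d then log 2 N + 1 else 1)) \<le>
        \<bar>C\<bar> * (N ^ (k * max m ?d) * (if m = ?d then log 2 N + 1 else 1))" by (intro mult_right_mono) auto
      with C(2)[OF N1] show "real (card ?T) \<le> \<bar>C\<bar> * N ^ (k * max m ?d) * (if m = ?d then log 2 N + 1 else 1)"
        by (simp only: mult.assoc)
    qed simp
    also have "\<dots> \<le> real n ^ ?d * (\<bar>C\<bar> * N ^ (k * max m ?d) * (if m = ?d then c * ln (real n) else 1))"
    proof -
      have ln2: "0 < ln (2::real)" "ln 2 \<le> ln (real n)" using n by auto
      have "log 2 N + 1 = (ln (real ?d) + ln (real n)) / ln 2 + 1"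
        using n d1 by (simp add: log_def N_def ln_mult)
      also have "\<dots> = ln (real ?d) / ln 2 * 1 + ln (real n) / ln 2 + 1" by (simp add: add_divide_distrib)
      also have "\<dots> \<le> ln (real ?d) / ln 2 * (ln (real n) / ln 2) + ln (real n) / ln 2 + ln (real n) / ln 2"
        using ln2 d1 by (intro add_mono mult_left_mono) auto
      also have "\<dots> = c * ln (real n)" by (simp add: c_def field_simps power2_eq_square)
      finally show ?thesis using N1 by (intro mult_left_mono) auto
    qed
    also have "\<dots> = \<bar>C\<bar> * real ?d ^ (k * max m ?d) * (if m = ?d then c else 1) * growth ?d k r n"
      by (simp add: growth_def m N_def power_mult_distrib power_add algebra_simps)
    finally show "real (coflat_count TYPE('d) n k r) \<le>
      \<bar>C\<bar> * real ?d ^ (k * max m ?d) * (if m = ?d then c else 1) * growth ?d k r n" .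
  qed
qed

section \<open>The lower bound\<close>

text \<open>Tuples are required to lie in a flat of dimension exactly \<open>k\<close>; a smaller
  affine hull is enlarged by adding points outside it one at a time.\<close>

lemma ex_affine_superset:
  fixes S :: "'a::euclidean_space set"
  assumes "aff_dim S \<le> int k" "k \<le> DIM('a)"
  shows "\<exists>T. affine T \<and> aff_dim T = int k \<and> S \<subseteq> T"
proof -
  have "\<exists>T. affine T \<and> aff_dim T = int k \<and> S \<subseteq> T" if "aff_dim S + int n = int k" for n and S :: "'a set"
    using that
  proof (induction n arbitrary: S)
    case 0
    then show ?case by (intro exI[of _ "affine hull S"]) (auto simp: hull_subset)
  next
    case (Suc n)
    have "affine hull S \<noteq> UNIV"
    proof
      assume "affine hull S = UNIV"
      then have "aff_dim S = int DIM('a)" by (metis aff_dim_UNIV aff_dim_affine_hull)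
      with Suc.prems assms(2) show False by simp
    qed
    then obtain x where "x \<notin> affine hull S" by blast
    then have "aff_dim (insert x S) + int n = int k" using Suc.prems by (simp add: aff_dim_insert)
    from Suc.IH[OF this] show ?case by blast
  qed
  from this[of S "nat (int k - aff_dim S)"] assms(1) show ?thesis by simp
qed

lemma coflat_tuplesI:
  assumes "length ps = r" "set ps \<subseteq> (grid n :: (real ^ 'd::finite) set)" "aff_dim (set ps) \<le> int k" "k \<le> CARD('d)"
  shows "ps \<in> coflat_tuples n k r"
  using assms ex_affine_superset[of "set ps" k] by (auto simp: coflat_tuples_def)

lemma finite_coflat_tuples: "finite (coflat_tuples n k r :: (real ^ 'd::finite) list set)"
  by (rule finite_subset[OF _ finite_lists_length_eq[OF finite_grid[of n], of r]]) (auto simp: coflat_tuples_def)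

lemma coflat_count_ge_card:
  assumes "inj_on f A" "f ` A \<subseteq> (coflat_tuples n k r :: (real ^ 'd::finite) list set)"
  shows "card A \<le> coflat_count TYPE('d) n k r"
  unfolding coflat_count_def by (rule card_inj_on_le[OF assms finite_coflat_tuples])

lemma aff_dim_le_span:
  fixes p :: "'a::euclidean_space"
  assumes "p \<in> S" "\<And>x. x \<in> S \<Longrightarrow> x - p \<in> span B" "finite B" "card B \<le> k"
  shows "aff_dim S \<le> int k"
proof -
  have "aff_dim S = int (dim ((\<lambda>x. x - p) ` S))"
    using assms(1) by (intro aff_dim_eq_dim_subtract hull_inc)
  also have "dim ((\<lambda>x. x - p) ` S) \<le> card B" using assms by (intro dim_le_card) auto
  finally show ?thesis using assms(4) by simp
qed

text \<open>Any \<open>k + 1\<close> points lie in a common \<open>k\<close>-flat; the remaining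
  entries repeat the first point, so they do not enlarge the hull.\<close>

lemma coflat_count_ge_free:
  assumes "k + 1 \<le> r" "k \<le> CARD('d::finite)"
  shows "n ^ (CARD('d) * (k + 1)) \<le> coflat_count TYPE('d) n k r"
proof -
  let ?A = "{xs :: (real ^ 'd) list. set xs \<subseteq> grid n \<and> length xs = k + 1}"
  let ?f = "\<lambda>xs :: (real ^ 'd) list. xs @ replicate (r - (k + 1)) (hd xs)"
  have "card ?A \<le> coflat_count TYPE('d) n k r"
  proof (rule coflat_count_ge_card[of ?f])
    show "inj_on ?f ?A" by (rule inj_onI) simp
    show "?f ` ?A \<subseteq> coflat_tuples n k r"
    proof
      fix ps assume "ps \<in> ?f ` ?A"
      then obtain xs where xs: "set xs \<subseteq> grid n" "length xs = k + 1" and ps: "ps = ?f xs" by blast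
      then have "xs \<noteq> []" by auto
      then have set: "set ps = set xs" by (auto simp: ps)
      have "aff_dim (set xs) \<le> int (card (set xs)) - 1" by (rule aff_dim_le_card) simp
      also have "\<dots> \<le> int k" using card_length[of xs] xs(2) by simp
      finally show "ps \<in> coflat_tuples n k r"
        using xs assms by (intro coflat_tuplesI) (simp_all only: set, simp_all add: ps)
    qed
  qed
  also have "card ?A = (n ^ CARD('d)) ^ (k + 1)"
    by (subst card_lists_length_eq[OF finite_grid]) (simp only: card_grid)
  finally show ?thesis by (simp only: power_mult)
qed

text \<open>Through each grid point \<open>p\<close> passes a flat parallel to \<open>k\<close>
  fixed coordinate axes; it contains \<open>n ^ k\<close> grid points, among which the other
  \<open>r - 1\<close> entries are free.\<close>

lemma coflat_count_ge_parallel: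
  assumes "k \<le> CARD('d::finite)" "0 < r"
  shows "n ^ (CARD('d) + k * (r - 1)) \<le> coflat_count TYPE('d) n k r"
proof -
  obtain I :: "'d set" where I: "card I = k" using obtain_subset_with_card_n[OF assms(1)] by blast
  define S where "S p = {x \<in> grid n. \<forall>i. i \<notin> I \<longrightarrow> x $ i = p $ i}" for p :: "real ^ 'd"
  have finS: "finite (S p)" for p unfolding S_def by (rule finite_subset[OF _ finite_grid[of n]]) auto
  have cardS: "card (S p) = n ^ k" if p: "p \<in> grid n" for p
  proof -
    have "bij_betw (\<lambda>x. restrict (vec_nth x) I) (S p) (PiE I (\<lambda>_. real ` {1..n}))"
      by (rule bij_betwI[where g = "\<lambda>f. \<chi> i. if i \<in> I then f i else p $ i"])
         (use p in \<open>auto simp: S_def grid_def vec_eq_iff fun_eq_iff PiE_def extensional_def Pi_iff\<close>)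
    then have "card (S p) = card (PiE I (\<lambda>_. real ` {1..n}))" by (rule bij_betw_same_card)
    also have "\<dots> = card (real ` {1..n}) ^ k" using I by (simp add: card_PiE)
    also have "card (real ` {1..n}) = n" by (subst card_image) auto
    finally show ?thesis .
  qed
  let ?A = "SIGMA p:grid n. {qs. set qs \<subseteq> S p \<and> length qs = r - 1}"
  let ?f = "\<lambda>(p, qs). p # qs"
  have "n ^ (CARD('d) + k * (r - 1)) = (\<Sum>p\<in>(grid n :: (real ^ 'd) set). (n ^ k) ^ (r - 1))"
    by (simp add: card_grid power_add power_mult)
  also have "\<dots> = (\<Sum>p\<in>grid n. card {qs. set qs \<subseteq> S p \<and> length qs = r - 1})"
    by (intro sum.cong refl) (simp add: card_lists_length_eq[OF finS] cardS)
  also have "\<dots> = card ?A"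
    by (intro card_SigmaI[symmetric]) (auto intro: finite_grid finite_lists_length_eq[OF finS])
  also have "\<dots> \<le> coflat_count TYPE('d) n k r"
  proof (rule coflat_count_ge_card[of ?f])
    show "inj_on ?f ?A" by (auto simp: inj_on_def)
    show "?f ` ?A \<subseteq> coflat_tuples n k r"
    proof
      fix ps assume "ps \<in> ?f ` ?A"
      then obtain p qs where ps: "ps = p # qs" "p \<in> grid n" "set qs \<subseteq> S p" "length qs = r - 1" by auto
      have "aff_dim (set ps) \<le> int k"
      proof (rule aff_dim_le_span[of p _ "(\<lambda>i. axis i 1) ` I"])
        fix x assume "x \<in> set ps"
        then have "x $ i = p $ i" if "i \<notin> I" for i using ps that by (auto simp: S_def)
        then have "x - p = (\<Sum>i\<in>I. (x $ i - p $ i) *\<^sub>R axis i 1)"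
          by (auto simp: vec_eq_iff axis_def if_distrib cong: if_cong)
        also have "\<dots> \<in> span ((\<lambda>i. axis i 1) ` I)" by (intro span_sum span_scale span_base) auto
        finally show "x - p \<in> span ((\<lambda>i. axis i 1) ` I)" .
      qed (use ps I card_image_le[of I "\<lambda>i. axis i (1::real)"] in auto)
      with ps assms show "ps \<in> coflat_tuples n k r" by (intro coflat_tuplesI) (auto simp: S_def)
    qed
  qed
  finally show ?thesis .
qed

section \<open>Arithmetic and linear algebra for the critical case\<close>

text \<open>The correction \<open>1 / real P\<close> makes the induction telescope.\<close>

lemma sum_inverse_squares: "P \<ge> 1 \<Longrightarrow> (\<Sum>t=1..P. 1 / (real t)^2) \<le> 2 - 1 / real P"
proof (induction P rule: dec_induct)
  case (step n)
  have "1 / (real (Suc n))^2 \<le> 1 / (real n * real (Suc n))"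
    using step.hyps by (intro divide_left_mono) (auto simp: power2_eq_square)
  also have "\<dots> = 1 / real n - 1 / real (Suc n)" using step.hyps by (simp add: field_simps)
  finally show ?case using step by simp
qed simp

text \<open>Writing a fraction in lowest terms, \<open>\<Sum>q\<le>P. 1 / q = \<Sum>q\<le>P. \<Sum>g dvd q. totient g / q\<^sup>2\<close>.\<close>

lemma sum_totient_ge_ln:
  assumes "P \<ge> 1"
  shows "ln (real P) \<le> 2 * (\<Sum>q=1..P. real (totient q) / (real q)^2)"
proof -
  have "ln (real P) \<le> ln (real P + 1)" using assms by (subst ln_le_cancel_iff) auto
  also have "\<dots> \<le> harm P" using ln_le_harm[of P] by (simp add: add.commute)
  also have "\<dots> = (\<Sum>q=1..P. \<Sum>g | g dvd q. real (totient g) / (real q)^2)"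
    unfolding harm_def
  proof (intro sum.cong refl)
    fix q assume q: "q \<in> {1..P}"
    have "(\<Sum>g | g dvd q. real (totient g) / (real q)^2) = real (\<Sum>g | g dvd q. totient g) / (real q)^2"
      by (simp add: sum_divide_distrib)
    also have "\<dots> = inverse (real q)" using q by (simp add: totient_divisor_sum power2_eq_square field_simps)
    finally show "inverse (real q) = (\<Sum>g | g dvd q. real (totient g) / (real q)^2)" ..
  qed
  also have "\<dots> = (\<Sum>q=1..P. \<Sum>g\<in>{1..P}. if g dvd q then real (totient g) / (real q)^2 else 0)"
  proof (rule sum.cong[OF refl])
    fix q assume q: "q \<in> {1..P}"
    then have "{g. g dvd q} = {g \<in> {1..P}. g dvd q}" by (auto dest: dvd_imp_le intro: Suc_leI dvd_pos_nat)
    then show "(\<Sum>g | g dvd q. real (totient g) / (real q)^2) = (\<Sum>g\<in>{1..P}. if g dvd q then real (totient g) / (real q)^2 else 0)"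
      by (simp only: sum.inter_filter[OF finite_atLeastAtMost])
  qed
  also have "\<dots> = (\<Sum>g=1..P. \<Sum>q\<in>{q\<in>{1..P}. g dvd q}. real (totient g) / (real q)^2)"
    by (subst sum.swap) (simp only: sum.inter_filter[OF finite_atLeastAtMost])
  also have "\<dots> \<le> (\<Sum>g=1..P. 2 * (real (totient g) / (real g)^2))"
  proof (rule sum_mono)
    fix g assume g: "g \<in> {1..P}"
    \<comment> \<open>Writing the multiples as \<open>q = g * t\<close> splits off
      \<open>totient g / g^2\<close>, and the sum of the inverse squares of \<open>t\<close> is at
      most 2.\<close>
    have "(\<Sum>q\<in>{q\<in>{1..P}. g dvd q}. real (totient g) / (real q)^2) \<le> (\<Sum>q\<in>(\<lambda>t. g * t) ` {1..P}. real (totient g) / (real q)^2)"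
    proof (rule sum_mono2)
      show "{q \<in> {1..P}. g dvd q} \<subseteq> (\<lambda>t. g * t) ` {1..P}"
      proof
        fix q assume "q \<in> {q \<in> {1..P}. g dvd q}"
        then obtain t where t: "q = g * t" "1 \<le> q" "q \<le> P" by auto
        then have "t \<ge> 1" by (cases t) auto
        moreover have "t \<le> g * t" using g by simp
        then have "t \<le> P" using t by linarith
        ultimately show "q \<in> (\<lambda>t. g * t) ` {1..P}" using t by (intro image_eqI[of _ _ t]) auto
      qed
    qed auto
    also have "\<dots> = (\<Sum>t=1..P. real (totient g) / (real (g * t))^2)"
      using g by (subst sum.reindex) (auto simp: inj_on_def)
    also have "\<dots> = (real (totient g) / (real g)^2) * (\<Sum>t=1..P. 1 / (real t)^2)"
      by (simp add: sum_distrib_left power_mult_distrib)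
    also have "\<dots> \<le> (real (totient g) / (real g)^2) * 2"
      by (intro mult_left_mono order_trans[OF sum_inverse_squares[OF assms]]) auto
    finally show "(\<Sum>q\<in>{q\<in>{1..P}. g dvd q}. real (totient g) / (real q)^2) \<le> 2 * (real (totient g) / (real g)^2)"
      by (simp only: mult.commute)
  qed
  finally show ?thesis by (simp add: sum_distrib_left)
qed

text \<open>Among any \<open>q\<close> consecutive integers exactly one satisfies the congruence,
  and the interval contains \<open>P div q\<close> full blocks.\<close>

lemma card_residue_interval:
  assumes "0 < q"
  shows "P div q \<le> card {x \<in> {o'..<o' + P}. q dvd c + x}"
proof -
  \<comment> \<open>Offset of the first solution; the outer \<open>mod q\<close> covers the case
    that \<open>c + o'\<close> is already divisible by \<open>q\<close>.\<close>
  define \<rho> where "\<rho> = (q - (c + o') mod q) mod q"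
  have \<rho>: "\<rho> < q" "q dvd (c + o') + \<rho>"
  proof -
    show "\<rho> < q" using assms by (simp add: \<rho>_def)
    have "((c + o') + \<rho>) mod q = ((c + o') mod q + (q - (c + o') mod q)) mod q"
      unfolding \<rho>_def by (simp add: mod_simps)
    also have "\<dots> = 0" using assms by (simp add: less_imp_le)
    finally show "q dvd (c + o') + \<rho>" by (simp add: mod_eq_0_iff_dvd)
  qed
  have "card {..<P div q} \<le> card {x \<in> {o'..<o' + P}. q dvd c + x}"
  proof (rule card_inj_on_le[of "\<lambda>u. o' + \<rho> + u * q"])
    show "inj_on (\<lambda>u. o' + \<rho> + u * q) {..<P div q}" using assms by (auto simp: inj_on_def)
    show "(\<lambda>u. o' + \<rho> + u * q) ` {..<P div q} \<subseteq> {x \<in> {o'..<o' + P}. q dvd c + x}"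
    proof
      fix x assume "x \<in> (\<lambda>u. o' + \<rho> + u * q) ` {..<P div q}"
      then obtain u where u: "u < P div q" "x = o' + \<rho> + u * q" by auto
      have "\<rho> + u * q < Suc u * q" using \<rho>(1) by simp
      also have "\<dots> \<le> (P div q) * q" using u(1) by (intro mult_right_mono) auto
      also have "\<dots> \<le> P" by simp
      finally have "x < o' + P" using u(2) by simp
      moreover have "q dvd ((c + o') + \<rho>) + u * q" using \<rho>(2) by simp
      then have "q dvd c + x" by (simp add: u(2) add.assoc)
      ultimately show "x \<in> {x \<in> {o'..<o' + P}. q dvd c + x}" using u(2) by simp
    qed
  qed simp
  then show ?thesis by simp
qed

text \<open>Since \<open>\<alpha> 0 = 1\<close>, all coordinates but the one at 0 can be chosen
  freely, and the divisibility is then a congruence for that coordinate alone.\<close>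

lemma card_rows:
  fixes \<alpha> off :: "nat \<Rightarrow> nat"
  assumes "0 < q" "0 < k" "\<alpha> 0 = 1"
  shows "P ^ (k - 1) * (P div q) \<le>
    card {x \<in> PiE {..<k} (\<lambda>i. {off i..<off i + P}). q dvd (\<Sum>i<k. \<alpha> i * x i)}"
proof -
  define T where "T y = {x \<in> {off 0..<off 0 + P}. q dvd (\<Sum>i=1..<k. \<alpha> i * y i) + x}" for y :: "nat \<Rightarrow> nat"
  let ?Y = "PiE {1..<k} (\<lambda>i. {off i..<off i + P})"
  have fin: "finite ?Y" by (intro finite_PiE) auto
  have ins: "{..<k} = insert 0 {1..<k}" using assms(2) by auto
  have "P ^ (k - 1) * (P div q) = (\<Sum>y\<in>?Y. P div q)" by (simp add: card_PiE)
  also have "\<dots> \<le> (\<Sum>y\<in>?Y. card (T y))" unfolding T_def by (intro sum_mono card_residue_interval assms)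
  also have "\<dots> = card (SIGMA y:?Y. T y)" using fin by (intro card_SigmaI[symmetric]) (auto simp: T_def)
  also have "\<dots> \<le> card {x \<in> PiE {..<k} (\<lambda>i. {off i..<off i + P}). q dvd (\<Sum>i<k. \<alpha> i * x i)}"
  proof (rule card_inj_on_le[of "\<lambda>(y, x0). y(0 := x0)"])
    show "inj_on (\<lambda>(y, x0). y(0 := x0)) (Sigma ?Y T)"
    proof (rule inj_onI, clarify)
      fix y x y' x' assume y: "y \<in> ?Y" "y' \<in> ?Y" and eq: "y(0 := x) = y'(0 := x' :: nat)"
      have "x = x'" using fun_cong[OF eq, of 0] by simp
      moreover have "y = y'"
      proof (rule PiE_ext[OF y])
        fix i assume "i \<in> {1..<k}"
        then show "y i = y' i" using fun_cong[OF eq, of i] by simp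
      qed
      ultimately show "y = y' \<and> x = x'" by simp
    qed
    show "(\<lambda>(y, x0). y(0 := x0)) ` Sigma ?Y T \<subseteq> {x \<in> PiE {..<k} (\<lambda>i. {off i..<off i + P}). q dvd (\<Sum>i<k. \<alpha> i * x i)}"
    proof clarify
      fix y x assume y: "y \<in> ?Y" and x: "x \<in> T y"
      have "y(0 := x) \<in> PiE {..<k} (\<lambda>i. {off i..<off i + P})"
        unfolding ins using y x by (intro PiE_fun_upd) (auto simp: T_def)
      moreover have "(\<Sum>i<k. \<alpha> i * (y(0 := x)) i) = x + (\<Sum>i=1..<k. \<alpha> i * y i)"
        unfolding ins using assms(3) by simp
      ultimately show "y(0 := x) \<in> PiE {..<k} (\<lambda>i. {off i..<off i + P}) \<and> q dvd (\<Sum>i<k. \<alpha> i * (y(0 := x)) i)"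
        using x by (simp add: T_def add.commute)
    qed
    show "finite {x \<in> PiE {..<k} (\<lambda>i. {off i..<off i + P}). q dvd (\<Sum>i<k. \<alpha> i * x i)}"
      by (rule finite_subset[of _ "PiE {..<k} (\<lambda>i. {off i..<off i + P})"]) (auto intro: finite_PiE)
  qed
  finally show ?thesis .
qed

text \<open>In the row \<open>s\<close> where \<open>\<bar>z s\<bar>\<close> is maximal, the
  diagonal term has size at least \<open>k * P * \<bar>z s\<bar>\<close>, while the other
  \<open>k - 1\<close> terms together reach at most
  \<open>(k - 1) * P * \<bar>z s\<bar>\<close>.\<close>

lemma diagonally_dominant_kernel:
  fixes X :: "nat \<Rightarrow> nat \<Rightarrow> nat" and z :: "nat \<Rightarrow> real"
  assumes diag: "\<And>s. s < k \<Longrightarrow> k * P \<le> X s s"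
    and off: "\<And>s i. s < k \<Longrightarrow> i < k \<Longrightarrow> i \<noteq> s \<Longrightarrow> X s i < P"
    and P: "0 < P"
    and eq: "\<And>s. s < k \<Longrightarrow> (\<Sum>i<k. real (X s i) * z i) = 0" and i: "i < k"
  shows "z i = 0"
proof -
  have "Max ((\<lambda>i. \<bar>z i\<bar>) ` {..<k}) \<in> (\<lambda>i. \<bar>z i\<bar>) ` {..<k}" using i by (intro Max_in) auto
  then obtain s where s: "s < k" "\<bar>z s\<bar> = Max ((\<lambda>i. \<bar>z i\<bar>) ` {..<k})" by auto
  have smax: "\<bar>z l\<bar> \<le> \<bar>z s\<bar>" if "l < k" for l unfolding s(2) using that by (intro Max_ge) auto
  have "real (X s s) * z s = - (\<Sum>l\<in>{..<k} - {s}. real (X s l) * z l)"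
    using eq[OF s(1)] s(1) by (subst (asm) sum.remove[of _ s]) auto
  then have "real (X s s) * \<bar>z s\<bar> = \<bar>\<Sum>l\<in>{..<k} - {s}. real (X s l) * z l\<bar>"
    by (metis abs_minus_cancel abs_mult abs_of_nat)
  also have "\<dots> \<le> (\<Sum>l\<in>{..<k} - {s}. real (X s l) * \<bar>z l\<bar>)"
    by (rule order_trans[OF sum_abs]) (simp add: abs_mult)
  also have "\<dots> \<le> (\<Sum>l\<in>{..<k} - {s}. real P * \<bar>z s\<bar>)"
    using off s smax by (intro sum_mono mult_mono) (auto simp: less_imp_le)
  also have "\<dots> = real (k - 1) * (real P * \<bar>z s\<bar>)" using s(1) by simp
  finally have 1: "real (X s s) * \<bar>z s\<bar> \<le> real (k - 1) * (real P * \<bar>z s\<bar>)" .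
  have "real (k * P) * \<bar>z s\<bar> \<le> real (X s s) * \<bar>z s\<bar>" using diag[OF s(1)] by (intro mult_right_mono) (simp_all del: of_nat_mult)
  with 1 have "real k * (real P * \<bar>z s\<bar>) \<le> real (k - 1) * (real P * \<bar>z s\<bar>)" by simp
  then have "real P * \<bar>z s\<bar> \<le> 0" using s(1) by (simp add: of_nat_diff algebra_simps)
  then have "z s = 0" using P by (simp add: mult_le_0_iff)
  then show ?thesis using smax[OF i] by simp
qed

text \<open>Reduction modulo \<open>q\<close> preserves coprimality, so cross-multiplying makes each
  denominator divide the other.\<close>

lemma reduced_fraction_unique:
  fixes b q b' q' :: nat
  assumes "coprime b q" "coprime b' q'" "real (b mod q) / real q = real (b' mod q') / real q'" "0 < q" "0 < q'"
  shows "q = q'"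
proof -
  have "real ((b mod q) * q') = real ((b' mod q') * q)" using assms(3-5) by (simp add: field_simps)
  then have eq: "(b mod q) * q' = (b' mod q') * q" by (simp only: of_nat_eq_iff)
  have c: "coprime (b mod q) q" "coprime (b' mod q') q'" using assms by (simp_all add: coprime_mod_left_iff)
  have "q dvd (b mod q) * q'" by (simp add: eq)
  then have "q dvd q'" using c(1) by (simp add: coprime_dvd_mult_right_iff coprime_commute)
  moreover have "q' dvd (b' mod q') * q" by (simp flip: eq)
  then have "q' dvd q" using c(2) by (simp add: coprime_dvd_mult_right_iff coprime_commute)
  ultimately show ?thesis by (rule dvd_antisym)
qed

text \<open>The tuples counted in the critical case: \<open>q\<close> and \<open>Y i l = (\<alpha> i * b l) mod q / q\<close> describe the
  \<open>k\<close>-dimensional subspace \<open>{(x, x Y)}\<close>, whose lattice points are the \<open>x\<close> with \<open>q dvd \<Sum>i. \<alpha> i * x i\<close>.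
  Normalising \<open>\<alpha> 0 = 1\<close> and \<open>b k\<close> coprime to \<open>q\<close> makes \<open>(q, \<alpha>, b)\<close> recoverable from \<open>Y\<close>, and a matrix
  of rows \<open>x\<close> with dominant diagonal makes \<open>Y\<close> recoverable from the points.\<close>

locale slanted_flats =
  fixes idx :: "'d::finite \<Rightarrow> nat" and k P :: nat
  assumes idx: "bij_betw idx UNIV {..<CARD('d)}" and k: "0 < k" "k < CARD('d)" and P: "0 < P"
begin

text \<open>Builds in the normalisation \<open>\<alpha> 0 = 1\<close>, so that \<open>a\<close> is
  stored on \<open>{1..<k}\<close> only.\<close>

definition first_one :: "(nat \<Rightarrow> nat) \<Rightarrow> nat \<Rightarrow> nat" where
  "first_one a i = (if i = 0 then 1 else a i)"

definition slope :: "nat \<times> (nat \<Rightarrow> nat) \<times> (nat \<Rightarrow> nat) \<Rightarrow> nat \<Rightarrow> nat \<Rightarrow> real" where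
  "slope = (\<lambda>(q, a, b) i l. real ((first_one a i * b l) mod q) / real q)"

text \<open>\<open>totatives q\<close> lies in \<open>{1..q}\<close>, not in \<open>{..<q}\<close>;
  this matters only for \<open>q = 1\<close>, where the residue 0 is represented by 1.\<close>

definition slopes :: "(nat \<times> (nat \<Rightarrow> nat) \<times> (nat \<Rightarrow> nat)) set" where
  "slopes = (SIGMA q:{1..P}. PiE {1..<k} (\<lambda>_. {..<q}) \<times>
     PiE {k..<CARD('d)} (\<lambda>l. if l = k then totatives q else {..<q}))"

text \<open>The divisibility makes x Y integral. The offset \<open>k * P\<close> on the diagonal
  makes the first \<open>k\<close> rows diagonally dominant; rows with \<open>s \<ge> k\<close> have
  no offset.\<close>

definition row_choices :: "nat \<times> (nat \<Rightarrow> nat) \<times> (nat \<Rightarrow> nat) \<Rightarrow> nat \<Rightarrow> (nat \<Rightarrow> nat) set" where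
  "row_choices = (\<lambda>(q, a, b) s.
     {x \<in> PiE {..<k} (\<lambda>i. {(if s = i then k * P else 0)..<(if s = i then k * P else 0) + P}).
        q dvd (\<Sum>i<k. first_one a i * x i)})"

definition shift :: "nat \<times> (nat \<Rightarrow> nat) \<times> (nat \<Rightarrow> nat) \<Rightarrow> (nat \<Rightarrow> nat) \<Rightarrow> real ^ 'd" where
  "shift t x = (\<chi> c. if idx c < k then real (x (idx c)) else (\<Sum>i<k. real (x i) * slope t i (idx c)))"

lemma ex_idx: "l < CARD('d) \<Longrightarrow> \<exists>c. idx c = l"
  using idx by (metis bij_betw_imp_surj_on image_iff lessThan_iff)

lemma finite_rows: "finite (row_choices t s)"
  unfolding row_choices_def split_def
  by (rule finite_subset[of _ "PiE {..<k} (\<lambda>i. {(if s = i then k * P else 0)..<(if s = i then k * P else 0) + P})"])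
     (auto intro: finite_PiE)

lemma finite_slopes: "finite slopes"
  unfolding slopes_def by (intro finite_SigmaI finite_cartesian_product finite_PiE) auto

lemma rows_le: "x \<in> row_choices t s \<Longrightarrow> i < k \<Longrightarrow> x i < (if s = i then k * P else 0) + P"
  unfolding row_choices_def split_def by (auto dest!: PiE_mem)

lemma sum_rows_le:
  assumes "x \<in> row_choices t s"
  shows "(\<Sum>i<k. x i) \<le> 2 * k * P"
proof -
  have "(\<Sum>i<k. x i) \<le> (\<Sum>i<k. (if s = i then k * P else 0) + P)"
    by (intro sum_mono) (use rows_le[OF assms] in \<open>auto simp: less_imp_le\<close>)
  also have "\<dots> = (\<Sum>i<k. if s = i then k * P else 0) + k * P" by (simp add: sum.distrib)
  also have "(\<Sum>i<k. if s = i then k * P else 0) \<le> k * P" by simp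
  finally show ?thesis by simp
qed

text \<open>As Y has rank one modulo 1, a single divisibility condition on \<open>x\<close> makes
  every coordinate of x Y integral; the entries of Y are below 1, so the value is at most the sum of
  the \<open>x i\<close>.\<close>

lemma slope_sum_eq_nat:
  assumes t: "t \<in> slopes" and x: "x \<in> row_choices t s"
  shows "\<exists>y \<le> 2 * k * P. (\<Sum>i<k. real (x i) * slope t i l) = real y"
proof -
  obtain q a b where qab: "t = (q, a, b)" by (cases t)
  have q: "q > 0" using t by (auto simp: slopes_def qab)
  let ?S = "\<Sum>i<k. x i * ((first_one a i * b l) mod q)"
  have "q dvd (\<Sum>i<k. first_one a i * x i) * b l" using x by (simp add: row_choices_def qab)
  then have "(\<Sum>i<k. x i * (first_one a i * b l)) mod q = 0"
    by (simp add: sum_distrib_right sum_distrib_left algebra_simps mod_eq_0_iff_dvd)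
  moreover have "?S mod q = (\<Sum>i<k. x i * (first_one a i * b l)) mod q"
    by (subst mod_sum_eq[symmetric], subst (2) mod_sum_eq[symmetric]) (simp add: mod_mult_right_eq)
  ultimately have "?S mod q = 0" by simp
  then obtain y where y: "?S = q * y" by (metis mod_0_imp_dvd dvdE)
  have "(\<Sum>i<k. real (x i) * slope t i l) = real ?S / real q"
    by (simp add: slope_def qab sum_divide_distrib)
  also have "\<dots> = real y" using q by (simp only: y) simp
  finally have "(\<Sum>i<k. real (x i) * slope t i l) = real y" .
  moreover have "q * y \<le> q * (\<Sum>i<k. x i)"
    unfolding y[symmetric] sum_distrib_left
    by (intro sum_mono) (use q in \<open>simp add: mult.commute less_imp_le\<close>)
  then have "y \<le> 2 * k * P" using q sum_rows_le[OF x] by simp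
  ultimately show ?thesis by blast
qed

lemma shift_grid:
  assumes t: "t \<in> slopes" and x: "x \<in> row_choices t s" and p: "p \<in> grid N" and n: "N + 2 * k * P \<le> n"
  shows "p + shift t x \<in> grid n"
proof -
  have "(p + shift t x) $ c \<in> real ` {1..n}" for c
  proof -
    have "p $ c \<in> real ` {1..N}" using p unfolding grid_def by blast
    then obtain m where m: "p $ c = real m" "1 \<le> m" "m \<le> N" by auto
    obtain y where "shift t x $ c = real y" "y \<le> 2 * k * P"
    proof (cases "idx c < k")
      case True
      have "x (idx c) \<le> (\<Sum>i<k. x i)" using True by (intro member_le_sum) auto
      with sum_rows_le[OF x] True that[of "x (idx c)"] show ?thesis by (simp add: shift_def)
    next
      case False
      with slope_sum_eq_nat[OF t x, of "idx c"] that show ?thesis by (auto simp: shift_def)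
    qed
    then have "(p + shift t x) $ c = real (m + y)" "m + y \<in> {1..n}" using m n by auto
    then show ?thesis by blast
  qed
  then show ?thesis by (simp add: grid_def)
qed

text \<open>\<open>shift t\<close> is linear in \<open>x\<close>, so the images of the
  \<open>k\<close> unit vectors span all shifts.\<close>

lemma shift_in_span:
  "shift t x \<in> span ((\<lambda>j. shift t (\<lambda>i. if i = j then 1 else 0)) ` {..<k})"
proof -
  have "shift t x = (\<Sum>j<k. real (x j) *\<^sub>R shift t (\<lambda>i. if i = j then 1 else 0))"
  proof (rule vec_eq_iff[THEN iffD2], rule allI)
    fix c
    show "shift t x $ c = (\<Sum>j<k. real (x j) *\<^sub>R shift t (\<lambda>i. if i = j then 1 else 0)) $ c"
    proof (cases "idx c < k")
      case True
      then have "(\<Sum>j<k. real (x j) * (if idx c = j then 1 else 0)) = real (x (idx c))"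
        by (simp add: if_distrib[of "\<lambda>r. _ * r"] cong: if_cong)
      with True show ?thesis by (simp add: shift_def if_distrib[of real] cong: if_cong)
    next
      case False
      have "(\<Sum>i<k. real (if i = j then 1 else 0) * slope t i (idx c)) = slope t j (idx c)" if "j < k" for j
        using that by (simp add: if_distrib[of real] if_distrib[of "\<lambda>r. r * _"] cong: if_cong)
      with False show ?thesis by (simp add: shift_def)
    qed
  qed
  also have "\<dots> \<in> span ((\<lambda>j. shift t (\<lambda>i. if i = j then 1 else 0)) ` {..<k})"
    by (intro span_sum span_scale span_base) auto
  finally show ?thesis .
qed

text \<open>The entry at \<open>(0, k)\<close> is the class of \<open>b k / q\<close> modulo 1, a
  reduced fraction, and reveals \<open>q\<close>; row 0 then reveals \<open>b\<close>, and column
  \<open>k\<close> reveals \<open>a\<close> after cancelling \<open>b k\<close>, a unit modulo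
  \<open>q\<close>.\<close>

lemma slope_inj:
  assumes t: "t \<in> slopes" "t' \<in> slopes"
    and eq: "\<And>i l. i < k \<Longrightarrow> k \<le> l \<Longrightarrow> l < CARD('d) \<Longrightarrow> slope t i l = slope t' i l"
  shows "t = t'"
proof -
  obtain q a b q' a' b' where qab: "t = (q, a, b)" "t' = (q', a', b')" by (cases t, cases t')
  have q: "0 < q" "0 < q'" using t by (auto simp: slopes_def qab)
  have bk: "b k \<in> totatives q" "b' k \<in> totatives q'"
    using t k unfolding slopes_def qab by (fastforce dest: PiE_mem)+
  then have cop: "coprime (b k) q" "coprime (b' k) q'" by (auto simp: totatives_def)
  have "real (b k mod q) / real q = real (b' k mod q') / real q'"
    using eq[of 0 k] k by (simp add: slope_def qab first_one_def)
  then have qq: "q = q'" by (rule reduced_fraction_unique[OF cop _ q])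
  have Y: "(first_one a i * b l) mod q = (first_one a' i * b' l) mod q" if "i < k" "k \<le> l" "l < CARD('d)" for i l
    using eq[OF that] q by (simp add: slope_def qab qq)
  have a: "a \<in> PiE {1..<k} (\<lambda>_. {..<q})" "a' \<in> PiE {1..<k} (\<lambda>_. {..<q})"
    and b: "b \<in> PiE {k..<CARD('d)} (\<lambda>l. if l = k then totatives q else {..<q})"
      "b' \<in> PiE {k..<CARD('d)} (\<lambda>l. if l = k then totatives q else {..<q})"
    using t unfolding slopes_def qab qq by (simp_all only: mem_Sigma_iff)
  have "b l = b' l" if l: "l \<in> {k..<CARD('d)}" for l
  proof -
    have eqm: "b l mod q = b' l mod q" using Y[of 0 l] k l by (simp add: first_one_def)
    show ?thesis
    proof (cases "l = k")
      case False
      then have "b l < q" "b' l < q" using PiE_mem[OF b(1) l] PiE_mem[OF b(2) l] by auto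
      with eqm show ?thesis by simp
    next
      case True
      have r: "0 < b k" "b k \<le> q" "0 < b' k" "b' k \<le> q" using bk qq by (auto simp: totatives_def)
      \<comment> \<open>Both lie in \<open>{1..q}\<close>, so equal residues force equality once the
        residue 0 is matched with \<open>q\<close>.\<close>
      have "b k = b' k"
      proof (cases "b k = q \<or> b' k = q")
        case True
        then have "b k mod q = 0" "b' k mod q = 0" using eqm \<open>l = k\<close> by auto
        then have "q \<le> b k" "q \<le> b' k" using r by (auto simp: mod_eq_0_iff_dvd dvd_imp_le)
        with r show ?thesis by simp
      next
        case False
        with r eqm \<open>l = k\<close> show ?thesis by simp
      qed
      with True show ?thesis by simp
    qed
  qed
  then have bb: "b = b'" using b by (intro PiE_ext[OF b]) auto
  have "a i = a' i" if i: "i \<in> {1..<k}" for i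
  proof -
    have "[a i * b k = a' i * b k] (mod q)"
      using Y[of i k] i k bb by (simp add: first_one_def cong_def)
    then have "[a i = a' i] (mod q)" using cong_mult_rcancel_nat[OF cop(1)] by blast
    moreover have "a i < q" "a' i < q" using PiE_mem[OF a(1) i] PiE_mem[OF a(2) i] by auto
    ultimately show ?thesis by (simp add: cong_def)
  qed
  then have "a = a'" by (intro PiE_ext[OF a]) auto
  with bb qq qab show ?thesis by simp
qed

text \<open>Base points stay in the lower half of the grid; the shifts use the other half.\<close>

definition params :: "nat \<Rightarrow> ((real ^ 'd) \<times> (nat \<times> (nat \<Rightarrow> nat) \<times> (nat \<Rightarrow> nat)) \<times> (nat \<Rightarrow> nat \<Rightarrow> nat)) set" where
  "params n = grid (n div 2) \<times> (SIGMA t:slopes. PiE {..<CARD('d)} (row_choices t))"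

definition points :: "(real ^ 'd) \<times> (nat \<times> (nat \<Rightarrow> nat) \<times> (nat \<Rightarrow> nat)) \<times> (nat \<Rightarrow> nat \<Rightarrow> nat) \<Rightarrow> (real ^ 'd) list" where
  "points = (\<lambda>(p, t, X). p # map (\<lambda>s. p + shift t (X s)) [0..<CARD('d)])"

text \<open>The head of the list is \<open>p\<close>, and the first \<open>k\<close> coordinates of
  the differences are the rows of \<open>X\<close>. The first \<open>k\<close> rows form an
  invertible matrix by diagonal dominance, which then determines Y column by column.\<close>

lemma points_inj: "inj_on points (params n)"
proof (rule inj_onI)
  fix u u' assume u: "u \<in> params n" "u' \<in> params n" "points u = points u'"
  obtain p t X p' t' X' where uu: "u = (p, t, X)" "u' = (p', t', X')" by (cases u, cases u')
  have t: "t \<in> slopes" "t' \<in> slopes" and X: "X \<in> PiE {..<CARD('d)} (row_choices t)" "X' \<in> PiE {..<CARD('d)} (row_choices t')"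
    using u by (auto simp: params_def uu)
  have pp: "p = p'" using u(3) by (simp add: points_def uu)
  have sh: "shift t (X s) = shift t' (X' s)" if "s < CARD('d)" for s
    using u(3) that by (auto simp: points_def uu)
  have row: "X s \<in> row_choices t s" "X' s \<in> row_choices t' s" if "s < CARD('d)" for s using X that by (auto dest: PiE_mem)
  have Xs: "X s = X' s" if s: "s < CARD('d)" for s
  proof -
    have "X s i = X' s i" if i: "i < k" for i
    proof -
      obtain c where c: "idx c = i" using ex_idx[of i] i k by auto
      then have "shift t (X s) $ c = shift t' (X' s) $ c" using sh[OF s] by simp
      then show ?thesis using c i by (simp add: shift_def)
    qed
    moreover have "X s \<in> extensional {..<k}" "X' s \<in> extensional {..<k}"
      using row[OF s] by (auto simp: row_choices_def split_def PiE_def)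
    ultimately show ?thesis by (intro extensionalityI[of _ "{..<k}"]) auto
  qed
  have "slope t i l = slope t' i l" if i: "i < k" and l: "k \<le> l" "l < CARD('d)" for i l
  proof -
    have "slope t i l - slope t' i l = 0"
    proof (rule diagonally_dominant_kernel[of k P X "\<lambda>i. slope t i l - slope t' i l"])
      show "0 < P" by (rule P)
      show "i < k" by (rule i)
    next
      fix s assume s: "s < k"
      then show "k * P \<le> X s s" using row(1)[of s] k unfolding row_choices_def split_def by (auto dest!: PiE_mem)
      show "X s i < P" if "i < k" "i \<noteq> s" for i
        using rows_le[OF row(1), of s i] that s k by auto
      obtain c where c: "idx c = l" using ex_idx l by blast
      have "shift t (X s) $ c = shift t' (X' s) $ c" using sh s k by simp
      then show "(\<Sum>i<k. real (X s i) * (slope t i l - slope t' i l)) = 0"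
        using c l Xs[of s] s k by (simp add: shift_def right_diff_distrib sum_subtractf)
    qed
    then show ?thesis by simp
  qed
  then have tt: "t = t'" by (rule slope_inj[OF t])
  have "X = X'" using X Xs by (intro PiE_ext[OF X(1)]) (auto simp: tt)
  with pp tt uu show "u = u'" by simp
qed

lemma points_coflat:
  assumes n: "4 * k * P \<le> n"
  shows "points ` params n \<subseteq> coflat_tuples n k (CARD('d) + 1)"
proof
  fix ps assume "ps \<in> points ` params n"
  then obtain p t X where p: "p \<in> grid (n div 2)" and t: "t \<in> slopes" and X: "X \<in> PiE {..<CARD('d)} (row_choices t)"
    and ps: "ps = p # map (\<lambda>s. p + shift t (X s)) [0..<CARD('d)]"
    by (auto simp: params_def points_def)
  show "ps \<in> coflat_tuples n k (CARD('d) + 1)"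
  proof (rule coflat_tuplesI)
    show "length ps = CARD('d) + 1" by (simp add: ps)
    show "k \<le> CARD('d)" using k by simp
    have "n div 2 + 2 * k * P \<le> n" using n by linarith
    then have "p + shift t (X s) \<in> grid n" if "s < CARD('d)" for s
      using shift_grid[OF t _ p] X that by (auto dest: PiE_mem)
    moreover have "p \<in> grid n" using p by (fastforce simp: grid_def)
    ultimately show "set ps \<subseteq> grid n" by (auto simp: ps)
    show "aff_dim (set ps) \<le> int k"
    proof (rule aff_dim_le_span)
      show "p \<in> set ps" by (simp add: ps)
      show "x - p \<in> span ((\<lambda>j. shift t (\<lambda>i. if i = j then 1 else 0)) ` {..<k})" if "x \<in> set ps" for x
        using that by (auto simp: ps span_zero intro: shift_in_span)
      show "card ((\<lambda>j. shift t (\<lambda>i. if i = j then 1 else 0)) ` {..<k}) \<le> k"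
        using card_image_le[of "{..<k}"] by (metis card_lessThan finite_lessThan)
    qed simp
  qed
qed

text \<open>For each \<open>q\<close> the first two factors count \<open>a\<close> and
  \<open>b\<close>; the \<open>CARD('d)\<close> rows are then chosen independently, each with at
  least the number of choices given by \<open>card_rows\<close>.\<close>

lemma card_params:
  "(n div 2) ^ CARD('d) * (\<Sum>q=1..P. q ^ (k - 1) * (totient q * q ^ (CARD('d) - k - 1)) * (P ^ (k - 1) * (P div q)) ^ CARD('d))
     \<le> card (params n)"
proof -
  let ?d = "CARD('d)"
  let ?A = "\<lambda>q. PiE {1..<k} (\<lambda>_. {..<q}) :: (nat \<Rightarrow> nat) set"
  let ?B = "\<lambda>q. PiE {k..<?d} (\<lambda>l. if l = k then totatives q else {..<q})"
  have cB: "card (?B q) = totient q * q ^ (?d - k - 1)" for q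
  proof -
    have "{k..<?d} = insert k {Suc k..<?d}" using k by auto
    then show ?thesis by (simp add: card_PiE totient_def)
  qed
  have "(\<Sum>q=1..P. q ^ (k - 1) * (totient q * q ^ (?d - k - 1)) * (P ^ (k - 1) * (P div q)) ^ ?d)
     = (\<Sum>q=1..P. \<Sum>ab\<in>?A q \<times> ?B q. (P ^ (k - 1) * (P div q)) ^ ?d)"
    by (simp add: card_cartesian_product cB card_PiE)
  also have "\<dots> = (\<Sum>(q, ab)\<in>slopes. (P ^ (k - 1) * (P div q)) ^ ?d)"
    unfolding slopes_def by (subst sum.Sigma) (auto intro!: finite_cartesian_product finite_PiE)
  also have "\<dots> \<le> (\<Sum>t\<in>slopes. card (PiE {..<?d} (row_choices t)))"
  proof (rule sum_mono)
    fix t assume t: "t \<in> slopes"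
    obtain q a b where qab: "t = (q, a, b)" by (cases t)
    have "(P ^ (k - 1) * (P div q)) ^ ?d = (\<Prod>s<?d. P ^ (k - 1) * (P div q))" by simp
    also have "\<dots> \<le> (\<Prod>s<?d. card (row_choices t s))"
    proof (intro prod_mono conjI)
      fix s show "P ^ (k - 1) * (P div q) \<le> card (row_choices t s)"
        unfolding row_choices_def qab split using t k
        by (intro card_rows) (auto simp: slopes_def qab first_one_def)
    qed simp
    also have "\<dots> = card (PiE {..<?d} (row_choices t))" by (simp add: card_PiE)
    finally show "(case t of (q, ab) \<Rightarrow> (P ^ (k - 1) * (P div q)) ^ ?d) \<le> card (PiE {..<?d} (row_choices t))"
      by (simp add: qab)
  qed
  also have "\<dots> = card (SIGMA t:slopes. PiE {..<?d} (row_choices t))"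
    using finite_slopes finite_rows by (intro card_SigmaI[symmetric]) (auto intro!: finite_PiE)
  finally have "(\<Sum>q=1..P. q ^ (k - 1) * (totient q * q ^ (?d - k - 1)) * (P ^ (k - 1) * (P div q)) ^ ?d) \<le>
      card (SIGMA t:slopes. PiE {..<?d} (row_choices t))" .
  then show ?thesis by (simp add: params_def card_cartesian_product card_grid)
qed

text \<open>The powers of \<open>q\<close> from \<open>a\<close> and \<open>b\<close> have total
  exponent d - 2, against d factors \<open>P div q\<close> of size about P / q; what remains is
  \<open>totient q / q^2\<close>, summed by \<open>sum_totient_ge_ln\<close>.\<close>

lemma coflat_count_critical_ge:
  assumes n: "4 * k * P \<le> n"
  shows "real (n div 2) ^ CARD('d) * (real P ^ k / 2) ^ CARD('d) * (ln (real P) / 2)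
    \<le> real (coflat_count TYPE('d) n k (CARD('d) + 1))"
proof -
  let ?d = "CARD('d)"
  have "(real P ^ k / 2) ^ ?d * (ln (real P) / 2) \<le> (real P ^ k / 2) ^ ?d * (\<Sum>q=1..P. real (totient q) / (real q)^2)"
    using sum_totient_ge_ln[of P] P by (intro mult_left_mono) auto
  also have "\<dots> = (\<Sum>q=1..P. (real P ^ k / 2) ^ ?d * (real (totient q) / (real q)^2))"
    by (simp add: sum_distrib_left)
  also have "\<dots> \<le> (\<Sum>q=1..P. real (q ^ (k - 1) * (totient q * q ^ (?d - k - 1)) * (P ^ (k - 1) * (P div q)) ^ ?d))"
  proof (rule sum_mono)
    fix q assume q: "q \<in> {1..P}"
    \<comment> \<open>Since \<open>q \<le> P\<close>, rounding down loses at most a factor of 2 in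
      \<open>P div q\<close>.\<close>
    have "P < q * (P div q) + q" using q by (metis Suc_le_eq atLeastAtMost_iff dividend_less_times_div One_nat_def add.commute mult.commute)
    moreover have "q \<le> q * (P div q)" using q by (simp add: div_greater_zero_iff Suc_leI)
    ultimately have "P \<le> 2 * (q * (P div q))" by linarith
    then have "real P \<le> real (2 * (q * (P div q)))" by (subst of_nat_le_iff)
    then have Pq: "real P / 2 / real q \<le> real (P div q)" using q by (simp add: field_simps)
    have Pk: "real P ^ k = real P ^ (k - 1) * real P" using k(1) by (cases k) auto
    have qd: "real q ^ ?d = real q ^ (k - 1) * real q ^ (?d - k - 1) * (real q)^2"
    proof -
      have "?d = (k - 1) + (?d - k - 1) + 2" using k by simp
      then have "real q ^ ?d = real q ^ ((k - 1) + (?d - k - 1) + 2)" by (rule arg_cong)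
      then show ?thesis by (simp only: power_add)
    qed
    have "(real P ^ k / 2) ^ ?d * (real (totient q) / (real q)^2) =
      real q ^ (k - 1) * (real (totient q) * real q ^ (?d - k - 1)) * (real P ^ (k - 1) * (real P / 2 / real q)) ^ ?d"
      using q by (simp add: Pk power_mult_distrib power_divide qd)
    also have "\<dots> \<le> real q ^ (k - 1) * (real (totient q) * real q ^ (?d - k - 1)) * (real P ^ (k - 1) * real (P div q)) ^ ?d"
      using Pq by (intro mult_left_mono power_mono) auto
    finally show "(real P ^ k / 2) ^ ?d * (real (totient q) / (real q)^2) \<le>
      real (q ^ (k - 1) * (totient q * q ^ (?d - k - 1)) * (P ^ (k - 1) * (P div q)) ^ ?d)" by simp
  qed
  finally have *: "(real P ^ k / 2) ^ ?d * (ln (real P) / 2) \<le> real (\<Sum>q=1..P. q ^ (k - 1) * (totient q * q ^ (?d - k - 1)) * (P ^ (k - 1) * (P div q)) ^ ?d)"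
    by (simp only: of_nat_sum)
  have "real (n div 2) ^ ?d * ((real P ^ k / 2) ^ ?d * (ln (real P) / 2)) \<le>
    real (n div 2) ^ ?d * real (\<Sum>q=1..P. q ^ (k - 1) * (totient q * q ^ (?d - k - 1)) * (P ^ (k - 1) * (P div q)) ^ ?d)"
    by (rule mult_left_mono[OF *]) simp
  also have "\<dots> = real ((n div 2) ^ ?d * (\<Sum>q=1..P. q ^ (k - 1) * (totient q * q ^ (?d - k - 1)) * (P ^ (k - 1) * (P div q)) ^ ?d))"
    by (simp only: of_nat_mult of_nat_power)
  also have "\<dots> \<le> real (card (params n))" by (subst of_nat_le_iff) (rule card_params)
  also have "\<dots> \<le> real (coflat_count TYPE('d) n k (?d + 1))"
    by (subst of_nat_le_iff) (rule coflat_count_ge_card[OF points_inj points_coflat[OF n]])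
  finally show ?thesis by (simp add: mult.assoc)
qed

end

section \<open>Choice of scale in the critical case and the final asymptotics\<close>

lemma ex_slanted_flats:
  assumes "0 < k" "k < CARD('d::finite)" "0 < P"
  shows "\<exists>idx :: 'd \<Rightarrow> nat. slanted_flats idx k P"
proof -
  obtain h :: "nat \<Rightarrow> 'd" where "bij_betw h {..<CARD('d)} UNIV"
    using ex_bij_betw_nat_finite[of "UNIV :: 'd set"] by (auto simp: atLeast0LessThan)
  then have "bij_betw (inv_into {..<CARD('d)} h) UNIV {..<CARD('d)}" by (rule bij_betw_inv_into)
  then show ?thesis using assms by (auto simp: slanted_flats_def)
qed

lemma half_le_div:
  assumes "0 < m" "m \<le> n"
  shows "real n / (2 * real m) \<le> real (n div m)"
proof -
  have "n < m * (n div m) + m" by (metis assms(1) dividend_less_times_div add.commute)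
  moreover have "m \<le> m * (n div m)" using assms by (simp add: div_greater_zero_iff Suc_leI)
  ultimately have "n \<le> 2 * (m * (n div m))" by linarith
  then have "real n \<le> real (2 * (m * (n div m)))" by (subst of_nat_le_iff)
  then show ?thesis using assms by (simp add: field_simps)
qed

lemma coflat_count_critical_lower:
  assumes k: "0 < k" "k < CARD('d::finite)"
  shows "\<exists>c>0. \<forall>n\<ge>64 * k\<^sup>2. c * (real n ^ (CARD('d) * (k + 1)) * ln (real n))
    \<le> real (coflat_count TYPE('d) n k (CARD('d) + 1))"
proof -
  let ?d = "CARD('d)"
  define c where "c = (1 / 4) ^ ?d * ((1 / (8 * real k)) ^ k / 2) ^ ?d / 4"
  have "c > 0" using k by (simp add: c_def)
  moreover have "c * (real n ^ (?d * (k + 1)) * ln (real n)) \<le> real (coflat_count TYPE('d) n k (?d + 1))"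
    if n: "n \<ge> 64 * k\<^sup>2" for n
  proof -
    \<comment> \<open>The largest scale that \<open>points_coflat\<close> allows.\<close>
    define P where "P = n div (4 * k)"
    have "4 * k \<le> 64 * k\<^sup>2" using k by (simp add: power2_eq_square)
    then have nk: "4 * k \<le> n" using n by linarith
    then have P: "0 < P" using k by (simp add: P_def div_greater_zero_iff)
    have P8: "real n / (8 * real k) \<le> real P" using half_le_div[OF _ nk] k by (simp add: P_def)
    have n2: "real n / 4 \<le> real (n div 2)" using half_le_div[of 2 n] nk k by simp
    have n0: "real n > 0" using nk k by simp
    \<comment> \<open>The bound on \<open>n\<close> says that \<open>n / (8 * k)\<close> is at least
      the square root of \<open>n\<close>, so the logarithm of \<open>P\<close> is at least half
      that of \<open>n\<close>.\<close>
    have "real (64 * k\<^sup>2) \<le> real n" using n by (subst of_nat_le_iff)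
    then have "real n * (64 * (real k)\<^sup>2) \<le> real n * real n" by (intro mult_left_mono) simp_all
    then have "real n \<le> (real n / (8 * real k))\<^sup>2" using k by (simp add: power_divide power_mult_distrib field_simps power2_eq_square)
    then have "ln (real n) \<le> ln ((real n / (8 * real k))\<^sup>2)" using n0 k by (subst ln_le_cancel_iff) auto
    also have "\<dots> = 2 * ln (real n / (8 * real k))" using n0 k by (simp add: ln_realpow)
    also have "\<dots> \<le> 2 * ln (real P)" using P8 n0 k P by (subst mult_le_cancel_left_pos) auto
    finally have lnP: "ln (real n) / 4 \<le> ln (real P) / 2" by simp
    have "ln (real n) \<ge> 0" using n0 by simp
    obtain idx :: "'d \<Rightarrow> nat" where "slanted_flats idx k P" using ex_slanted_flats[OF k P] by blast
    then interpret slanted_flats idx k P .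
    have "c * (real n ^ (?d * (k + 1)) * ln (real n)) =
      (real n / 4) ^ ?d * ((real n / (8 * real k)) ^ k / 2) ^ ?d * (ln (real n) / 4)"
      by (simp add: c_def power_divide power_mult_distrib power_mult[symmetric] power_add mult.commute)
    also have "\<dots> \<le> real (n div 2) ^ ?d * (real P ^ k / 2) ^ ?d * (ln (real P) / 2)"
      using P8 n2 lnP n0 k \<open>ln (real n) \<ge> 0\<close>
      by (intro mult_mono power_mono divide_right_mono) auto
    also have "\<dots> \<le> real (coflat_count TYPE('d) n k (?d + 1))"
    proof (rule coflat_count_critical_ge)
      show "4 * k * P \<le> n" by (simp add: P_def)
    qed
    finally show ?thesis .
  qed
  ultimately show ?thesis by blast
qed

theorem proposition1p8:
  fixes d k r :: nat
  assumes "CARD('d::finite) = d"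
    and "0 < d" and "0 < k" and "0 < r"
    and "k < d" and "k + 2 \<le> r"
  shows "(\<lambda>n. real (coflat_count TYPE('d) n k r)) \<in> \<Theta>(growth d k r)"
proof (rule bigthetaI)
  obtain C where C: "\<And>n. n \<ge> 2 \<Longrightarrow> real (coflat_count TYPE('d) n k r) \<le> C * growth d k r n"
    using coflat_count_upper[OF assms(4), where 'd='d and k=k] assms(1) by blast
  show "(\<lambda>n. real (coflat_count TYPE('d) n k r)) \<in> O(growth d k r)"
  proof (rule bigoI[of _ "\<bar>C\<bar>"])
    show "\<forall>\<^sub>F n in sequentially. norm (real (coflat_count TYPE('d) n k r)) \<le> \<bar>C\<bar> * norm (growth d k r n)"
      using eventually_ge_at_top[of 2]
    proof eventually_elim
      case (elim n)
      have "C * growth d k r n \<le> \<bar>C\<bar> * \<bar>growth d k r n\<bar>" by (metis abs_ge_self abs_mult)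
      with C[OF elim] show ?case by simp
    qed
  qed
  have "\<exists>c>0. \<exists>n0\<ge>1. \<forall>n\<ge>n0. c * growth d k r n \<le> real (coflat_count TYPE('d) n k r)"
  proof (cases "r - 1 = d")
    case True
    obtain c where "c > 0" "\<And>n. n \<ge> 64 * k\<^sup>2 \<Longrightarrow> c * (real n ^ (d * (k + 1)) * ln (real n)) \<le> real (coflat_count TYPE('d) n k (d + 1))"
      using coflat_count_critical_lower[where 'd='d and k=k] assms by auto
    moreover have "d + 1 = r" using True assms(4) by simp
    ultimately show ?thesis using True
      by (intro exI[of _ c] conjI exI[of _ "64 * k\<^sup>2"]) (use assms(3) in \<open>auto simp: growth_def\<close>)
  next
    case False
    \<comment> \<open>Off the critical case one of the two simpler constructions attains the maximum
      in the exponent, with constant 1 and for every \<open>n\<close>.\<close>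
    have "n ^ (d + k * max (r - 1) d) \<le> coflat_count TYPE('d) n k r" for n
    proof (cases "r - 1 < d")
      case True
      then show ?thesis using coflat_count_ge_free[where 'd='d, of k r n] assms by (simp add: max_def mult.commute)
    next
      case False
      then show ?thesis using coflat_count_ge_parallel[where 'd='d, of k r n] assms by (simp add: max_def)
    qed
    then have "1 * growth d k r n \<le> real (coflat_count TYPE('d) n k r)" for n
      using False by (simp add: growth_def flip: of_nat_power)
    then show ?thesis by (intro exI[of _ 1]) auto
  qed
  then obtain c n0 where c: "c > 0" "n0 \<ge> 1" "\<And>n. n \<ge> n0 \<Longrightarrow> c * growth d k r n \<le> real (coflat_count TYPE('d) n k r)"
    by blast
  show "(\<lambda>n. real (coflat_count TYPE('d) n k r)) \<in> \<Omega>(growth d k r)"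
  proof (rule landau_omega.bigI[OF c(1)])
    show "\<forall>\<^sub>F n in sequentially. c * norm (growth d k r n) \<le> norm (real (coflat_count TYPE('d) n k r))"
      using eventually_ge_at_top[of n0]
    proof eventually_elim
      case (elim n)
      \<comment> \<open>From \<open>n \<ge> n0 \<ge> 1\<close> the logarithm in
        \<open>growth\<close> is nonnegative.\<close>
      then have "growth d k r n \<ge> 0" using c(2) by (auto simp: growth_def)
      with c(3)[OF elim] show ?case by simp
    qed
  qed
qed

end
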